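(* Let $(X,\|\cdot\|_X)$ be a reflexive real Banach space and $\Psi\in\Gamma_G(X)$. Assume that $\Psi^*$ is Gateaux differentiable on $D\Psi(\mathrm{int\,dom}\,\Psi)$ and that $\varnothing\neq D\Psi(\mathrm{int\,dom}\,\Psi)\subseteq\mathrm{int\,dom}\,\Psi^*$. Let $\varnothing\neq K\subseteq\mathrm{int\,dom}\,\Psi$ be such that $D\Psi(K)\subseteq X^*$ is closed and convex. Suppose that any of the following (generally inequivalent) conditions holds: (a) $\Psi^*$ is totally convex on $\mathrm{dom}\,\Psi^*$; or (b) $\Psi^*$ is strictly convex on $\mathrm{dom}\,\Psi^*$ and supercoercive; or (c) $\Psi^*$ is Euler--Legendre. Then: (i) $K$ is right $D_\Psi$-Chebyshev, and $D_\Psi$ is right pythagorean on $K$; (ii) the right projection $\overrightarrow{P}_K$ is zone consistent, i.e. $\overrightarrow{P}_K(\mathrm{int\,dom}\,\Psi)\subseteq\mathrm{int\,dom}\,\Psi$; (iii) $D_{\Psi^*}$ is an information on $X^*$ (and, in case (c), $D_\Psi$ is an information on $X$); (iv) if $D\Psi(K)$ is affine, then $$D_\Psi(x,y)=D_\Psi(x,\overrightarrow{P}_K(x))+D_\Psi(\overrightarrow{P}_K(x),y)\quad\forall (x,y)\in\mathrm{int\,dom}\,\Psi\times K.$$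
   Context: $\langle\cdot,\cdot\rangle$ is the pairing of $X\times X^*$; by reflexivity $X^{**}=X$. For $\Psi:X\to\,]-\infty,\infty]$, $\mathrm{dom}\,\Psi=\{x:\Psi(x)\neq\infty\}$, and $\mathrm{int\,dom}\,\Psi$ is its norm interior. $\Gamma(X)$ is the set of proper convex lower semicontinuous $\Psi:X\to\,]-\infty,\infty]$; $\Gamma_G(X)$ is the set of those $\Psi\in\Gamma(X)$ with $\mathrm{int\,dom}\,\Psi\ne\varnothing$ that are Gateaux differentiable on $\mathrm{int\,dom}\,\Psi$, with Gateaux derivative $D\Psi(y)\in X^*$. $\Psi^*(y)=\sup_{x\in X}(\langle x,y\rangle-\Psi(x))$ is the convex conjugate on $X^*$. $\partial\Psi$ is the convex subdifferential, $\mathrm{dom}\,\partial\Psi=\{x:\partial\Psi(x)\ne\varnothing\}$, $(\partial\Psi)^{-1}(y)=\{x: y\in\partial\Psi(x)\}$. Vainberg--Bregman functional: $D_\Psi(x,y)=\Psi(x)-\Psi(y)-\langle x-y,D\Psi(y)\rangle$ for $x\in X$, $y\in\mathrm{int\,dom}\,\Psi$, and $D_\Psi(x,y)=\infty$ otherwise; $D_{\Psi^*}$ is defined likewise on $X^*\times X^*$. For a set $Z$, a function $D:Z\times Z\to[0,\infty]$ is called an information on $Z$ iff $D(x,y)=0\iff x=y$ for all $x,y\in Z$. Let $\Phi\in\Gamma(Z)$ for a Banach space $Z$. $\Phi$ is totally convex at $x\in\mathrm{dom}\,\Phi$ iff for all $t>0$, $\inf\{\Phi(y)-\Phi(x)-D_+\Phi(x;y-x):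 y\in\mathrm{dom}\,\Phi,\ \|y-x\|=t\}>0$, where $D_+\Phi(x;h)=\lim_{t\to0^+}(\Phi(x+th)-\Phi(x))/t$; it is totally convex on a set iff it is so at each point of the set. Supercoercive: $\lim_{\|x\|\to\infty}\Phi(x)/\|x\|=\infty$. Essentially Gateaux differentiable: $\mathrm{int\,dom}\,\Phi\neq\varnothing$ and $\partial\Phi(x)$ is a singleton for all $x\in\mathrm{dom}\,\partial\Phi$. Essentially strictly convex: $\Phi$ is strictly convex on every convex subset of $\mathrm{dom}\,\partial\Phi$, and there exists $\varepsilon>0$ such that for all $x\in\mathrm{dom}((\partial\Phi)^{-1})$, $\sup\{\|(\partial\Phi)^{-1}(x+\varepsilon y)\|: y\in Z^*,\ \|y\|\le1\}<\infty$ (the supremum being over the norms of all elements of these sets). Euler--Legendre: both essentially Gateaux differentiable and essentially strictly convex. $K\subseteq\mathrm{int\,dom}\,\Psi$ is right $D_\Psi$-Chebyshev iff for every $x\in\mathrm{int\,dom}\,\Psi$ the set of minimisers of $z\mapsto D_\Psi(x,z)$ over $z\in K$ is a singleton; its element is denoted $\overrightarrow{P}_K(x)$. $D_\Psi$ is right pythagorean on $K$ iff $K$ is right $D_\Psi$-Chebyshev and for any $x\in\mathrm{int\,dom}\,\Psi$ and $w\in K$ the following are equivalent: (1) $w=\overrightarrow{P}_K(x)$; (2) $w$ is the unique solution $z$ of $\langle x-z,D\Psi(z)-D\Psi(y)\rangle\ge0$ for all $y\in K$; (3) $w$ is the unique solution $z$ of $D_\Psi(x,z)+D_\Psi(z,y)\le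 D_\Psi(x,y)$ for all $y\in K$.
   Formalization: In (iii), "D_{Ψ*} is an information on X*" fails when int dom Ψ* ≠ X* (then D_{Ψ*}(y,y)=∞ off it, e.g. Ψ=exp); proved instead: D_{Ψ*}≥0 and D_{Ψ*}(x,y)=0 ⇒ x=y on all of X*, and D_{Ψ*} is an information on int dom Ψ*. *)

theory Defs
  imports "HOL-Analysis.Analysis"
begin

text \<open>
  The dual of a real normed space \<open>'a\<close> is \<open>'a \<Rightarrow>\<^sub>L real\<close> with the operator norm, and the pairing
  of \<open>x\<close> with \<open>f\<close> is \<open>blinfun_apply f x\<close>, a coercion that is mostly left implicit.
  All notions below are defined for functions
  \<open>\<Phi> :: 'a \<Rightarrow> ereal\<close> on an arbitrary normed space.  Applied to a conjugate, which lives on the dual,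
  derivatives and subgradients are elements of the bidual; on a reflexive space these are exactly
  the evaluations at points of \<open>'a\<close>.
\<close>

definition reflexive_space :: "'a::real_normed_vector itself \<Rightarrow> bool" where
  "reflexive_space (T :: 'a itself) \<longleftrightarrow>
     (\<forall>F :: ('a \<Rightarrow>\<^sub>L real) \<Rightarrow>\<^sub>L real. \<exists>x :: 'a. \<forall>f :: 'a \<Rightarrow>\<^sub>L real. blinfun_apply F f = blinfun_apply f x)"

definition edom :: "('a \<Rightarrow> ereal) \<Rightarrow> 'a set" where
  "edom \<Phi> = {x. \<Phi> x \<noteq> \<infinity>}"

definition proper :: "('a \<Rightarrow> ereal) \<Rightarrow> bool" where
  "proper \<Phi> \<longleftrightarrow> (\<forall>x. \<Phi> x \<noteq> -\<infinity>) \<and> edom \<Phi> \<noteq> {}"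

definition convex_fun :: "('a::real_vector \<Rightarrow> ereal) \<Rightarrow> bool" where
  "convex_fun \<Phi> \<longleftrightarrow> (\<forall>x y. \<forall>t\<in>{0<..<1}.
     \<Phi> ((1 - t) *\<^sub>R x + t *\<^sub>R y) \<le> ereal (1 - t) * \<Phi> x + ereal t * \<Phi> y)"

definition strictly_convex_fun_on :: "'a::real_vector set \<Rightarrow> ('a \<Rightarrow> ereal) \<Rightarrow> bool" where
  "strictly_convex_fun_on S \<Phi> \<longleftrightarrow> (\<forall>x\<in>S. \<forall>y\<in>S. \<forall>t\<in>{0<..<1}. x \<noteq> y \<longrightarrow>
     \<Phi> ((1 - t) *\<^sub>R x + t *\<^sub>R y) < ereal (1 - t) * \<Phi> x + ereal t * \<Phi> y)"

definition lower_semicontinuous :: "('a::topological_space \<Rightarrow> ereal) \<Rightarrow> bool" where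
  "lower_semicontinuous \<Phi> \<longleftrightarrow> (\<forall>x. \<Phi> x \<le> Liminf (at x) \<Phi>)"

definition Gamma :: "('a::real_normed_vector \<Rightarrow> ereal) set" where
  "Gamma = {\<Phi>. proper \<Phi> \<and> convex_fun \<Phi> \<and> lower_semicontinuous \<Phi>}"

definition has_gateaux_deriv ::
    "('a::real_normed_vector \<Rightarrow> ereal) \<Rightarrow> ('a \<Rightarrow>\<^sub>L real) \<Rightarrow> 'a \<Rightarrow> bool" where
  "has_gateaux_deriv \<Phi> f x \<longleftrightarrow>
     (\<forall>h. ((\<lambda>t. (\<Phi> (x + t *\<^sub>R h) - \<Phi> x) / ereal t) \<longlongrightarrow> ereal (f h)) (at 0))"

definition gateaux_differentiable_on ::
    "('a::real_normed_vector \<Rightarrow> ereal) \<Rightarrow> 'a set \<Rightarrow> bool" where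
  "gateaux_differentiable_on \<Phi> S \<longleftrightarrow> (\<forall>x\<in>S. \<exists>f. has_gateaux_deriv \<Phi> f x)"

definition gateaux_deriv :: "('a::real_normed_vector \<Rightarrow> ereal) \<Rightarrow> 'a \<Rightarrow> 'a \<Rightarrow>\<^sub>L real" where
  "gateaux_deriv \<Phi> x = (THE f. has_gateaux_deriv \<Phi> f x)"

definition Gamma_G :: "('a::real_normed_vector \<Rightarrow> ereal) set" where
  "Gamma_G = {\<Phi>\<in>Gamma. interior (edom \<Phi>) \<noteq> {} \<and>
     gateaux_differentiable_on \<Phi> (interior (edom \<Phi>))}"

definition conjugate :: "('a::real_normed_vector \<Rightarrow> ereal) \<Rightarrow> ('a \<Rightarrow>\<^sub>L real) \<Rightarrow> ereal" where
  "conjugate \<Phi> f = (SUP x. ereal (f x) - \<Phi> x)"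

definition subdifferential ::
    "('a::real_normed_vector \<Rightarrow> ereal) \<Rightarrow> 'a \<Rightarrow> ('a \<Rightarrow>\<^sub>L real) set" where
  "subdifferential \<Phi> x = {f. \<forall>y. \<Phi> x + ereal (blinfun_apply f (y - x)) \<le> \<Phi> y}"

definition dom_subdifferential :: "('a::real_normed_vector \<Rightarrow> ereal) \<Rightarrow> 'a set" where
  "dom_subdifferential \<Phi> = {x. subdifferential \<Phi> x \<noteq> {}}"

definition inv_subdifferential ::
    "('a::real_normed_vector \<Rightarrow> ereal) \<Rightarrow> ('a \<Rightarrow>\<^sub>L real) \<Rightarrow> 'a set" where
  "inv_subdifferential \<Phi> f = {x. f \<in> subdifferential \<Phi> x}"

definition dom_inv_subdifferential ::
    "('a::real_normed_vector \<Rightarrow> ereal) \<Rightarrow> ('a \<Rightarrow>\<^sub>L real) set" where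
  "dom_inv_subdifferential \<Phi> = {f. inv_subdifferential \<Phi> f \<noteq> {}}"

text \<open>The one-sided directional derivative is taken in the extended reals: at boundary points of
  the effective domain it may be \<open>-\<infinity>\<close>.\<close>

definition right_deriv :: "('a::real_normed_vector \<Rightarrow> ereal) \<Rightarrow> 'a \<Rightarrow> 'a \<Rightarrow> ereal" where
  "right_deriv \<Phi> x h = Lim (at_right 0) (\<lambda>t. (\<Phi> (x + t *\<^sub>R h) - \<Phi> x) / ereal t)"

definition totally_convex_at :: "('a::real_normed_vector \<Rightarrow> ereal) \<Rightarrow> 'a \<Rightarrow> bool" where
  "totally_convex_at \<Phi> x \<longleftrightarrow> (\<forall>t>0.
     0 < (INF y\<in>{y\<in>edom \<Phi>. norm (y - x) = t}. \<Phi> y - \<Phi> x - right_deriv \<Phi> x (y - x)))"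

definition totally_convex_on :: "'a::real_normed_vector set \<Rightarrow> ('a \<Rightarrow> ereal) \<Rightarrow> bool" where
  "totally_convex_on S \<Phi> \<longleftrightarrow> (\<forall>x\<in>S. totally_convex_at \<Phi> x)"

definition supercoercive :: "('a::real_normed_vector \<Rightarrow> ereal) \<Rightarrow> bool" where
  "supercoercive \<Phi> \<longleftrightarrow> ((\<lambda>x. \<Phi> x / ereal (norm x)) \<longlongrightarrow> \<infinity>) at_infinity"

definition ess_gateaux_differentiable :: "('a::real_normed_vector \<Rightarrow> ereal) \<Rightarrow> bool" where
  "ess_gateaux_differentiable \<Phi> \<longleftrightarrow> interior (edom \<Phi>) \<noteq> {} \<and>
     (\<forall>x\<in>dom_subdifferential \<Phi>. is_singleton (subdifferential \<Phi> x))"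

text \<open>One radius \<open>\<epsilon>\<close> serves all points of the domain of the inverse subdifferential.\<close>

definition ess_strictly_convex :: "('a::real_normed_vector \<Rightarrow> ereal) \<Rightarrow> bool" where
  "ess_strictly_convex \<Phi> \<longleftrightarrow>
     (\<forall>S. convex S \<and> S \<subseteq> dom_subdifferential \<Phi> \<longrightarrow> strictly_convex_fun_on S \<Phi>) \<and>
     (\<exists>\<epsilon>>0. \<forall>f\<in>dom_inv_subdifferential \<Phi>.
        (SUP z\<in>(\<Union>g\<in>cball 0 1. inv_subdifferential \<Phi> (f + \<epsilon> *\<^sub>R g)). ereal (norm z)) < \<infinity>)"

definition euler_legendre :: "('a::real_normed_vector \<Rightarrow> ereal) \<Rightarrow> bool" where
  "euler_legendre \<Phi> \<longleftrightarrow> ess_gateaux_differentiable \<Phi> \<and> ess_strictly_convex \<Phi>"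

text \<open>The Vainberg--Bregman functional.\<close>

definition vb_functional :: "('a::real_normed_vector \<Rightarrow> ereal) \<Rightarrow> 'a \<Rightarrow> 'a \<Rightarrow> ereal" where
  "vb_functional \<Phi> x y =
     (if y \<in> interior (edom \<Phi>) then \<Phi> x - \<Phi> y - ereal (gateaux_deriv \<Phi> y (x - y)) else \<infinity>)"

text \<open>Because of the value \<open>\<infinity>\<close> off the interior of the effective domain,
  \<open>vb_functional \<Phi> y y = 0\<close> holds only for \<open>y \<in> interior (edom \<Phi>)\<close>.  Hence \<open>vb_functional \<Phi>\<close>
  can be an information on the whole space only if this interior is the whole space.\<close>

definition information_on :: "'a set \<Rightarrow> ('a \<Rightarrow> 'a \<Rightarrow> ereal) \<Rightarrow> bool" where
  "information_on Z D \<longleftrightarrow> (\<forall>x\<in>Z. \<forall>y\<in>Z. 0 \<le> D x y \<and> (D x y = 0 \<longleftrightarrow> x = y))"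

definition right_minimisers ::
    "('a::real_normed_vector \<Rightarrow> ereal) \<Rightarrow> 'a set \<Rightarrow> 'a \<Rightarrow> 'a set" where
  "right_minimisers \<Phi> K x = {w\<in>K. \<forall>z\<in>K. vb_functional \<Phi> x w \<le> vb_functional \<Phi> x z}"

definition right_chebyshev :: "('a::real_normed_vector \<Rightarrow> ereal) \<Rightarrow> 'a set \<Rightarrow> bool" where
  "right_chebyshev \<Phi> K \<longleftrightarrow> K \<subseteq> interior (edom \<Phi>) \<and>
     (\<forall>x\<in>interior (edom \<Phi>). is_singleton (right_minimisers \<Phi> K x))"

definition right_projection ::
    "('a::real_normed_vector \<Rightarrow> ereal) \<Rightarrow> 'a set \<Rightarrow> 'a \<Rightarrow> 'a" where
  "right_projection \<Phi> K x = the_elem (right_minimisers \<Phi> K x)"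

text \<open>The solutions \<open>z\<close> in the two variational characterisations range over \<open>K\<close>.  (Over a larger
  set \<open>z = x\<close> would always be a solution.)\<close>

definition right_pythagorean :: "('a::real_normed_vector \<Rightarrow> ereal) \<Rightarrow> 'a set \<Rightarrow> bool" where
  "right_pythagorean \<Phi> K \<longleftrightarrow> right_chebyshev \<Phi> K \<and>
     (\<forall>x\<in>interior (edom \<Phi>). \<forall>w\<in>K.
        (w = right_projection \<Phi> K x \<longleftrightarrow>
         {z\<in>K. \<forall>y\<in>K. 0 \<le> (gateaux_deriv \<Phi> z - gateaux_deriv \<Phi> y) (x - z)} = {w}) \<and>
        (w = right_projection \<Phi> K x \<longleftrightarrow>
         {z\<in>K. \<forall>y\<in>K. vb_functional \<Phi> x z + vb_functional \<Phi> z y \<le> vb_functional \<Phi> x y} = {w}))"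

end

theory Submission
  imports Defs
begin

text \<open>
  Write \<open>p = D\<Psi>(z)\<close>.  Then \<open>D\<^sub>\<Psi>(x,z) = \<Psi>(x) + \<Psi>\<^sup>*(p) - \<langle>x,p\<rangle>\<close>, so the right projection of \<open>x\<close> minimises
  \<open>\<Psi>\<^sup>* - x\<close> over the closed convex set \<open>D\<Psi>(K)\<close>.  As \<open>\<Psi>\<close> is bounded near \<open>x\<close>, this function is
  coercive, and a minimising sequence has a weak cluster point, which is a minimiser.
  The variational inequality is its first order optimality condition, and the pythagorean inequality
  is equivalent to it by the three point identity
  \<open>D\<^sub>\<Psi>(x,y) - D\<^sub>\<Psi>(x,z) - D\<^sub>\<Psi>(z,y) = \<langle>x - z, D\<Psi>(z) - D\<Psi>(y)\<rangle>\<close>.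
  Strict convexity of \<open>\<Psi>\<^sup>*\<close> forces \<open>dom \<partial>\<Psi> = int dom \<Psi>\<close>, since at a boundary point \<open>\<Psi>\<^sup>*\<close> would be
  affine in the normal directions; hence \<open>int dom \<Psi>\<^sup>* = D\<Psi>(int dom \<Psi>)\<close>, where \<open>\<Psi>\<^sup>*\<close> is
  differentiable.
\<close>

section \<open>Hahn--Banach and separation\<close>

text \<open>Positive homogeneity is asked only as an inequality, which is the easy half to check for
  infima; \<open>sublinear_scale\<close> recovers equality by scaling back with
  \<open>1 / c\<close>.\<close>

definition sublinear :: "('a::real_vector \<Rightarrow> real) \<Rightarrow> bool" where
  "sublinear q \<longleftrightarrow> (\<forall>x y. q (x + y) \<le> q x + q y) \<and> (\<forall>c>0. \<forall>x. q (c *\<^sub>R x) \<le> c * q x)"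

lemma sublinear_add: "sublinear q \<Longrightarrow> q (x + y) \<le> q x + q y"
  by (simp add: sublinear_def)

lemma sublinear_scale:
  assumes "sublinear q" "c > 0"
  shows "q (c *\<^sub>R x) = c * q x"
proof (rule antisym)
  show "q (c *\<^sub>R x) \<le> c * q x"
    using assms by (simp add: sublinear_def)
  have "q ((1 / c) *\<^sub>R (c *\<^sub>R x)) \<le> (1 / c) * q (c *\<^sub>R x)"
    using assms unfolding sublinear_def by (meson zero_less_divide_1_iff)
  then show "c * q x \<le> q (c *\<^sub>R x)"
    using assms(2) by (simp add: field_simps)
qed

lemma sublinear_zero: "sublinear q \<Longrightarrow> q 0 = 0"
  using sublinear_scale[of q 2 0] by simp

lemma sublinear_minus: "sublinear q \<Longrightarrow> - q (- x) \<le> q x"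
  using sublinear_add[of q x "- x"] sublinear_zero[of q] by simp

text \<open>If \<open>q\<close> is minimal among sublinear functionals, then \<open>r = q\<close> and \<open>q (- h) = - q h\<close> for all \<open>h\<close>,
  so \<open>q\<close> is linear.\<close>

lemma sublinear_lower_along:
  fixes q :: "'a::real_vector \<Rightarrow> real"
  assumes q: "sublinear q"
  obtains r where "sublinear r" "r \<le> q" "r (- h) \<le> - q h"
proof
  \<comment> \<open>Taking \<open>t = 0\<close> in the infimum of \<open>g x t\<close> gives
    \<open>r \<le> q\<close>, and \<open>t = 1\<close> at the point \<open>- h\<close> gives
    \<open>r (- h) \<le> - q h\<close>. The infimum is finite by the bound
    \<open>low\<close>.\<close>
  define g where "g x t = q (x + t *\<^sub>R h) - t * q h" for x t
  define r where "r x = (INF t\<in>{0..}. g x t)" for x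
  have scale: "q (t *\<^sub>R h) = t * q h" if "t \<ge> 0" for t
    using that sublinear_scale[OF q] sublinear_zero[OF q] by (cases "t = 0") auto
  have low: "- q (- x) \<le> g x t" if "t \<ge> 0" for x t
    using sublinear_add[OF q, of "x + t *\<^sub>R h" "- x"] scale[OF that] by (simp add: g_def)
  have bdd: "bdd_below (g x ` {0..})" for x
    using low by (meson atLeast_iff bdd_belowI2)
  have r_le: "r x \<le> g x t" if "t \<ge> 0" for x t
    unfolding r_def using bdd that by (intro cINF_lower) auto
  have r_ge: "c \<le> r x" if "\<And>t. t \<ge> 0 \<Longrightarrow> c \<le> g x t" for c x
    unfolding r_def using that by (intro cINF_greatest) auto
  have add: "r (x + y) \<le> r x + r y" for x y
  proof -
    have "r (x + y) - g y t \<le> g x s" if "s \<ge> 0" "t \<ge> 0" for s t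
      using r_le[of "s + t" "x + y"] that sublinear_add[OF q, of "x + s *\<^sub>R h" "y + t *\<^sub>R h"]
      by (simp add: g_def algebra_simps)
    then have "r (x + y) - g y t \<le> r x" if "t \<ge> 0" for t
      using that r_ge by blast
    then have "r (x + y) - r x \<le> r y"
      by (intro r_ge) (simp add: algebra_simps)
    then show ?thesis by simp
  qed
  have "r (c *\<^sub>R x) \<le> c * r x" if "c > 0" for c x
  proof -
    have "r (c *\<^sub>R x) / c \<le> g x t" if "t \<ge> 0" for t
    proof -
      have "r (c *\<^sub>R x) \<le> g (c *\<^sub>R x) (c * t)"
        using r_le \<open>c > 0\<close> that by simp
      also have "\<dots> = c * g x t"
        using sublinear_scale[OF q \<open>c > 0\<close>, of "x + t *\<^sub>R h"] by (simp add: g_def algebra_simps)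
      finally show ?thesis
        using \<open>c > 0\<close> by (simp add: field_simps)
    qed
    then have "r (c *\<^sub>R x) / c \<le> r x"
      by (rule r_ge)
    then show ?thesis
      using that by (simp add: field_simps)
  qed
  with add show "sublinear r"
    by (simp add: sublinear_def)
  show "r \<le> q"
    using r_le[of 0] by (simp add: le_fun_def g_def)
  show "r (- h) \<le> - q h"
    using r_le[of 1 "- h"] sublinear_zero[OF q] by (simp add: g_def)
qed

text \<open>For subadditivity, two members \<open>f\<close> and \<open>g\<close> of the chain are
  both replaced by the smaller one. The bound \<open>- q (- x)\<close>, common to all sublinear
  functionals below \<open>q\<close>, keeps the infimum finite.\<close>

lemma sublinear_Inf_chain:
  fixes C :: "('a::real_vector \<Rightarrow> real) set"
  assumes C: "C \<noteq> {}" "\<And>f. f \<in> C \<Longrightarrow> sublinear f" "\<And>f. f \<in> C \<Longrightarrow> f \<le> q"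
    and chain: "\<And>f g. f \<in> C \<Longrightarrow> g \<in> C \<Longrightarrow> f \<le> g \<or> g \<le> f"
  shows "sublinear (\<lambda>x. INF f\<in>C. f x)" and "f \<in> C \<Longrightarrow> (\<lambda>x. INF f\<in>C. f x) \<le> f"
proof -
  define u where "u x = (INF f\<in>C. f x)" for x
  have "- q (- x) \<le> f x" if "f \<in> C" for f x
    using sublinear_minus[OF C(2)[OF that], of x] le_funD[OF C(3)[OF that], of "- x"] by linarith
  then have u_le: "u x \<le> f x" if "f \<in> C" for f x
    unfolding u_def using that by (intro cINF_lower bdd_belowI2[of _ "- q (- x)"]) auto
  have u_ge: "c \<le> u x" if "\<And>f. f \<in> C \<Longrightarrow> c \<le> f x" for c x
    unfolding u_def using that C by (intro cINF_greatest) auto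
  show "f \<in> C \<Longrightarrow> (\<lambda>x. INF f\<in>C. f x) \<le> f"
    using u_le by (simp add: le_fun_def u_def)
  have "u (x + y) \<le> u x + u y" for x y
  proof -
    have "u (x + y) - g y \<le> f x" if fg: "f \<in> C" "g \<in> C" for f g
    proof -
      from chain[OF fg] obtain k where k: "k \<in> C" "k \<le> f" "k \<le> g"
        using fg by auto
      have "u (x + y) \<le> k (x + y)"
        using u_le k by blast
      also have "\<dots> \<le> k x + k y"
        using sublinear_add C k by blast
      also have "\<dots> \<le> f x + g y"
        using k by (simp add: le_fun_def add_mono)
      finally show ?thesis by simp
    qed
    then have "u (x + y) - g y \<le> u x" if "g \<in> C" for g
      using u_ge that by blast
    then have "u (x + y) - u x \<le> u y"
      by (intro u_ge) (simp add: algebra_simps)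
    then show ?thesis by simp
  qed
  moreover have "u (c *\<^sub>R x) \<le> c * u x" if "c > 0" for c x
  proof -
    have "u (c *\<^sub>R x) / c \<le> f x" if "f \<in> C" for f
      using u_le[OF that, of "c *\<^sub>R x"] sublinear_scale[OF C(2)[OF that] \<open>c > 0\<close>] \<open>c > 0\<close>
      by (simp add: field_simps)
    then have "u (c *\<^sub>R x) / c \<le> u x"
      by (rule u_ge)
    then show ?thesis
      using that by (simp add: field_simps)
  qed
  ultimately show "sublinear (\<lambda>x. INF f\<in>C. f x)"
    by (simp add: sublinear_def u_def)
qed

text \<open>Zorn's lemma provides a minimal sublinear functional below \<open>q\<close>. Minimality
  makes it odd, and subadditivity applied to \<open>x\<close>, \<open>y\<close> and to their
  negatives then yields additivity.\<close>

theorem hahn_banach_sublinear: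
  fixes q :: "'a::real_vector \<Rightarrow> real"
  assumes q: "sublinear q"
  obtains F where "linear F" "F \<le> q"
proof -
  define A where "A = {f. sublinear f \<and> f \<le> q}"
  \<comment> \<open>Zorn's lemma speaks of maximal elements, so the pointwise order is
    reversed.\<close>
  define R where "R = (\<lambda>f g :: 'a \<Rightarrow> real. g \<le> f)"
  have "partial_order_on A (relation_of R A)"
    unfolding R_def
    by (rule partial_order_on_relation_ofI) auto
  moreover have "\<exists>u\<in>A. \<forall>a\<in>C. R a u" if "C \<in> Chains (relation_of R A)" for C
  proof (cases "C = {}")
    case True
    then show ?thesis using q by (auto simp: A_def)
  next
    case False
    have sub: "C \<subseteq> A" and chain: "\<And>f g. f \<in> C \<Longrightarrow> g \<in> C \<Longrightarrow> f \<le> g \<or> g \<le> f"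
      using that by (auto simp: Chains_def relation_of_def R_def)
    have *: "\<And>f. f \<in> C \<Longrightarrow> sublinear f" "\<And>f. f \<in> C \<Longrightarrow> f \<le> q"
      using sub by (auto simp: A_def)
    note u = sublinear_Inf_chain[OF False * chain]
    have "(\<lambda>x. INF f\<in>C. f x) \<le> q"
      using False u(2) * by (meson all_not_in_conv order_trans)
    with u show ?thesis
      by (intro bexI[of _ "\<lambda>x. INF f\<in>C. f x"]) (auto simp: A_def R_def)
  qed
  ultimately obtain m where m: "m \<in> A" "\<And>a. a \<in> A \<Longrightarrow> R m a \<Longrightarrow> a = m"
    using predicate_Zorn[of A R] by blast
  have sm: "sublinear m" and "m \<le> q"
    using m by (auto simp: A_def)
  have neg: "m (- h) = - m h" for h
  proof -
    obtain r where r: "sublinear r" "r \<le> m" "r (- h) \<le> - m h"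
      using sublinear_lower_along[OF sm] .
    then have "r = m"
      using m \<open>m \<le> q\<close> by (auto simp: A_def R_def)
    with r sublinear_minus[OF sm, of "- h"] show ?thesis by auto
  qed
  have "linear m"
  proof
    fix x y
    show "m (x + y) = m x + m y"
      using sublinear_add[OF sm, of x y] sublinear_add[OF sm, of "- x" "- y"] neg[of "x + y"]
        neg[of x] neg[of y]
      by (simp add: algebra_simps)
  next
    fix c x
    show "m (c *\<^sub>R x) = c *\<^sub>R m x"
    proof (cases c "0::real" rule: linorder_cases)
      case less
      then show ?thesis
        using sublinear_scale[OF sm, of "- c" x] neg[of "c *\<^sub>R x"] by simp
    qed (use sublinear_scale[OF sm, of c x] sublinear_zero[OF sm] in auto)
  qed
  with \<open>m \<le> q\<close> show thesis using that by blast
qed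

text \<open>The infimum of \<open>S h\<close> is sublinear in \<open>h\<close>: it is finite because
  adding an element of \<open>S (- h)\<close> lands in \<open>S 0\<close>. Giving upper bounds as a
  set lets the same argument serve for affine minorants and for weak cluster points.\<close>

lemma hahn_banach_cone:
  fixes S :: "'a::real_vector \<Rightarrow> real set"
  assumes ne: "\<And>h. S h \<noteq> {}"
    and add: "\<And>h k s t. s \<in> S h \<Longrightarrow> t \<in> S k \<Longrightarrow> s + t \<in> S (h + k)"
    and scale: "\<And>c h s. c > 0 \<Longrightarrow> s \<in> S h \<Longrightarrow> c * s \<in> S (c *\<^sub>R h)"
    and zero: "\<And>s. s \<in> S 0 \<Longrightarrow> 0 \<le> s"
  obtains F where "linear F" "\<And>h s. s \<in> S h \<Longrightarrow> F h \<le> s"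
proof -
  define q where "q h = Inf (S h)" for h
  have "bdd_below (S h)" for h
  proof -
    obtain t where t: "t \<in> S (- h)" using ne by blast
    have "- t \<le> s" if "s \<in> S h" for s
      using zero[of "s + t"] add[OF that t] by simp
    then show ?thesis by (rule bdd_belowI)
  qed
  then have q_le: "q h \<le> s" if "s \<in> S h" for h s
    unfolding q_def using that by (rule cInf_lower[rotated])
  have q_ge: "c \<le> q h" if "\<And>s. s \<in> S h \<Longrightarrow> c \<le> s" for c h
    unfolding q_def using that ne by (intro cInf_greatest) auto
  have "q (h + k) \<le> q h + q k" for h k
  proof -
    have "q (h + k) - t \<le> s" if "s \<in> S h" "t \<in> S k" for s t
      using q_le[OF add[OF that]] by simp
    then have "q (h + k) - t \<le> q h" if "t \<in> S k" for t
      using that q_ge by blast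
    then have "q (h + k) - q h \<le> q k"
      by (intro q_ge) (simp add: algebra_simps)
    then show ?thesis by simp
  qed
  moreover have "q (c *\<^sub>R h) \<le> c * q h" if "c > 0" for c h
  proof -
    have "q (c *\<^sub>R h) / c \<le> q h"
      using q_le[OF scale[OF that]] that by (intro q_ge) (simp add: field_simps)
    then show ?thesis
      using that by (simp add: field_simps)
  qed
  ultimately have "sublinear q"
    by (simp add: sublinear_def)
  then obtain F where F: "linear F" "F \<le> q"
    by (rule hahn_banach_sublinear)
  show thesis
  proof (rule that[OF F(1)])
    show "F h \<le> s" if "s \<in> S h" for h s
      using le_funD[OF F(2), of h] q_le[OF that] by linarith
  qed
qed

section \<open>Affine minorants and separation of convex sets\<close>

lemma linear_le_norm_blinfun:
  fixes F :: "'a::real_normed_vector \<Rightarrow> real"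
  assumes "linear F" and le: "\<And>h. F h \<le> M * norm h"
  obtains p :: "'a \<Rightarrow>\<^sub>L real" where "\<And>h. p h = F h"
proof
  interpret linear F by fact
  have "bounded_linear F"
  proof (intro bounded_linear_intro)
    show "norm (F h) \<le> norm h * M" for h
      using le[of h] le[of "- h"] by (simp add: neg mult.commute)
  qed (auto simp: add scale)
  then show "Blinfun F h = F h" for h
    by (simp add: bounded_linear_Blinfun_apply)
qed

text \<open>This is a sandwich theorem: the cone generated by \<open>E - (x, L)\<close> together
  with the epigraph of \<open>M * norm\<close> has only nonnegative heights above \<open>0\<close>,
  so a linear functional fits below it.\<close>

lemma affine_minorant_of_norm_minorant:
  fixes E :: "('a::real_normed_vector \<times> real) set"
  assumes E: "convex E" "E \<noteq> {}" and M: "M \<ge> 0"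
    and low: "\<And>z a. (z, a) \<in> E \<Longrightarrow> L - M * norm (z - x) \<le> a"
  obtains p :: "'a \<Rightarrow>\<^sub>L real" where "\<And>z a. (z, a) \<in> E \<Longrightarrow> L + p (z - x) \<le> a"
proof -
  \<comment> \<open>The choice \<open>t = 0\<close> puts \<open>M * norm h\<close> into
    \<open>S h\<close>, which makes the functional continuous; the choice \<open>t = 1\<close>,
    \<open>k = 0\<close> gives the desired minorant of \<open>E\<close>.\<close>
  define S where "S h = {s. \<exists>t z a k. 0 \<le> t \<and> (z, a) \<in> E \<and> h = t *\<^sub>R (z - x) + k
    \<and> t * (a - L) + M * norm k \<le> s}" for h
  obtain z0 a0 where z0: "(z0, a0) \<in> E" using E by auto
  have normS_le: "s \<in> S h" if "M * norm h \<le> s" for h s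
    unfolding S_def using z0 that
    by (intro CollectI exI[of _ 0] exI[of _ z0] exI[of _ a0] exI[of _ h]) auto
  then have normS: "M * norm h \<in> S h" for h
    by simp
  have add: "s1 + s2 \<in> S (h1 + h2)" if s: "s1 \<in> S h1" "s2 \<in> S h2" for h1 h2 s1 s2
  proof -
    obtain t1 z1 a1 k1 where 1: "0 \<le> t1" "(z1, a1) \<in> E" "h1 = t1 *\<^sub>R (z1 - x) + k1"
      "t1 * (a1 - L) + M * norm k1 \<le> s1"
      using s(1) unfolding S_def by blast
    obtain t2 z2 a2 k2 where 2: "0 \<le> t2" "(z2, a2) \<in> E" "h2 = t2 *\<^sub>R (z2 - x) + k2"
      "t2 * (a2 - L) + M * norm k2 \<le> s2"
      using s(2) unfolding S_def by blast
    define t where "t = t1 + t2"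
    have norm: "M * norm (k1 + k2) \<le> M * norm k1 + M * norm k2"
      using M mult_left_mono[OF norm_triangle_ineq[of k1 k2] M] by (simp add: algebra_simps)
    show ?thesis
    proof (cases "t = 0")
      case True
      then have "t1 = 0" "t2 = 0" using 1 2 by (auto simp: t_def)
      then have "M * norm (h1 + h2) \<le> s1 + s2" using 1 2 norm by auto
      then show ?thesis by (rule normS_le)
    next
      case False
      then have "t > 0" using 1 2 by (auto simp: t_def)
      \<comment> \<open>The two conic multiples are merged into one multiple of a convex
        combination, with weights proportional to \<open>t1\<close> and \<open>t2\<close>.\<close>
      define z where "z = (t1 / t) *\<^sub>R z1 + (t2 / t) *\<^sub>R z2"
      define a where "a = (t1 / t) * a1 + (t2 / t) * a2"
      have "(t1 / t) *\<^sub>R (z1, a1) + (t2 / t) *\<^sub>R (z2, a2) \<in> E"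
        using 1 2 \<open>t > 0\<close>
        by (intro convexD[OF E(1)]) (simp_all add: t_def add_divide_distrib[symmetric])
      then have "(z, a) \<in> E" by (simp add: z_def a_def)
      moreover have "t *\<^sub>R z = t1 *\<^sub>R z1 + t2 *\<^sub>R z2"
        using \<open>t > 0\<close> by (simp add: z_def algebra_simps)
      then have "h1 + h2 = t *\<^sub>R (z - x) + (k1 + k2)"
        unfolding 1(3) 2(3) scaleR_diff_right by (simp add: t_def algebra_simps)
      moreover have "t * a = t1 * a1 + t2 * a2"
        using \<open>t > 0\<close> by (simp add: a_def field_simps)
      then have "t * (a - L) + M * norm (k1 + k2) \<le> s1 + s2"
        using 1 2 norm by (simp add: t_def algebra_simps)
      ultimately show ?thesis
        unfolding S_def using \<open>t > 0\<close> by (blast intro: less_imp_le)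
    qed
  qed
  have scale: "c * s \<in> S (c *\<^sub>R h)" if "c > 0" and s: "s \<in> S h" for c h s
  proof -
    obtain t z a k where *: "0 \<le> t" "(z, a) \<in> E" "h = t *\<^sub>R (z - x) + k"
      "t * (a - L) + M * norm k \<le> s"
      using s unfolding S_def by blast
    have "c * (t * (a - L) + M * norm k) \<le> c * s"
      using *(4) \<open>c > 0\<close> by simp
    then have "c * t * (a - L) + M * norm (c *\<^sub>R k) \<le> c * s"
      using \<open>c > 0\<close> by (simp add: algebra_simps)
    moreover have "c *\<^sub>R h = (c * t) *\<^sub>R (z - x) + c *\<^sub>R k"
      by (simp add: *(3) scaleR_add_right)
    moreover have "0 \<le> c * t"
      using *(1) \<open>c > 0\<close> by simp
    ultimately show ?thesis
      unfolding S_def using *(2) by blast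
  qed
  have zero: "0 \<le> s" if s: "s \<in> S 0" for s
  proof -
    obtain t z a k where *: "0 \<le> t" "(z, a) \<in> E" "0 = t *\<^sub>R (z - x) + k"
      "t * (a - L) + M * norm k \<le> s"
      using s unfolding S_def by blast
    have "norm k = t * norm (z - x)"
      using *(1,3) by (metis abs_of_nonneg add_eq_0_iff norm_minus_cancel norm_scaleR)
    then have "t * (a - L + M * norm (z - x)) \<le> s"
      using *(4) by (simp add: algebra_simps)
    moreover have "0 \<le> t * (a - L + M * norm (z - x))"
      using low[OF *(2)] *(1) by simp
    ultimately show ?thesis by linarith
  qed
  obtain F where F: "linear F" "\<And>h s. s \<in> S h \<Longrightarrow> F h \<le> s"
    using hahn_banach_cone[of S, OF _ add scale zero] normS by blast
  obtain p :: "'a \<Rightarrow>\<^sub>L real" where p: "\<And>h. p h = F h"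
    using linear_le_norm_blinfun[OF F(1)] F(2)[OF normS] by blast
  have "L + p (z - x) \<le> a" if "(z, a) \<in> E" for z a
  proof -
    have "a - L \<in> S (z - x)"
      unfolding S_def using that
      by (intro CollectI exI[of _ 1] exI[of _ z] exI[of _ a] exI[of _ 0]) auto
    then show ?thesis using F(2) p by fastforce
  qed
  then show thesis using that by blast
qed

text \<open>A ball of radius \<open>d\<close> around \<open>x\<close> misses \<open>C\<close>, so
  \<open>d - norm (z - x)\<close> is nonpositive on \<open>C\<close>; an affine minorant of
  \<open>C \<times> {0}\<close> with value \<open>d\<close> at \<open>x\<close> separates with gap
  \<open>d\<close>.\<close>

lemma separate_closed_convex:
  fixes C :: "'a::real_normed_vector set"
  assumes C: "closed C" "convex C" "C \<noteq> {}" and x: "x \<notin> C"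
  obtains p :: "'a \<Rightarrow>\<^sub>L real" and d where "d > 0" "\<And>z. z \<in> C \<Longrightarrow> p z \<le> p x - d"
proof -
  obtain d where d: "d > 0" "ball x d \<inter> C = {}"
    using C x by (metis ComplI open_Compl open_contains_ball disjoint_eq_subset_Compl)
  have "convex (C \<times> {0::real})"
    by (intro convex_Times C convex_singleton)
  moreover have "d - 1 * norm (z - x) \<le> a" if "(z, a) \<in> C \<times> {0}" for z a
    using that d by (force simp: dist_norm norm_minus_commute)
  ultimately obtain p :: "'a \<Rightarrow>\<^sub>L real" where p: "\<And>z a. (z, a) \<in> C \<times> {0} \<Longrightarrow> d + p (z - x) \<le> a"
    using affine_minorant_of_norm_minorant[of "C \<times> {0}" 1 d x] C by auto
  show thesis
    by (rule that[of d p]) (use p d in \<open>force simp: blinfun.diff_right\<close>)+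
qed

lemma blinfun_separates_points:
  fixes x y :: "'a::real_normed_vector"
  assumes "\<And>p :: 'a \<Rightarrow>\<^sub>L real. p x = p y"
  shows "x = y"
  using assms separate_closed_convex[of "{y}" x] by force

lemma separate_open_convex:
  fixes U :: "'a::real_normed_vector set"
  assumes U: "open U" "convex U" "U \<noteq> {}" and x: "x \<notin> U"
  obtains p :: "'a \<Rightarrow>\<^sub>L real" where "\<And>z. z \<in> U \<Longrightarrow> p z < p x"
proof -
  \<comment> \<open>The epigraph of minus the distance to the complement of \<open>U\<close>, which is at least
    \<open>- norm (z - x)\<close>.\<close>
  define E where "E = {(z, a). z \<in> U \<and> ball z (- a) \<subseteq> U}"
  have "convex E"
  proof (rule convexI)
    fix e1 e2 and u v :: real
    assume e: "e1 \<in> E" "e2 \<in> E" and uv: "0 \<le> u" "0 \<le> v" "u + v = 1"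
    obtain z1 a1 z2 a2 where e12: "e1 = (z1, a1)" "e2 = (z2, a2)" by fastforce
    then have U12: "z1 \<in> U" "z2 \<in> U" "ball z1 (- a1) \<subseteq> U" "ball z2 (- a2) \<subseteq> U"
      using e by (auto simp: E_def)
    define r1 where "r1 = max 0 (- a1)"
    define r2 where "r2 = max 0 (- a2)"
    have in1: "z1 + k \<in> U" if "norm k < r1 \<or> k = 0" for k
      using that U12 by (auto simp: r1_def dist_norm subset_iff max_def split: if_splits)
    have in2: "z2 + k \<in> U" if "norm k < r2 \<or> k = 0" for k
      using that U12 by (auto simp: r2_def dist_norm subset_iff max_def split: if_splits)
    have "u *\<^sub>R z1 + v *\<^sub>R z2 + k \<in> U" if k: "norm k < u * (- a1) + v * (- a2)" for k
    proof -
      \<comment> \<open>The vector \<open>k\<close> is shared between the two points in proportion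
        to their radii, so that each share stays in its own ball. A radius \<open>0\<close> receives
        the share \<open>0\<close>, and the centre lies in \<open>U\<close> anyway.\<close>
      define r where "r = u * r1 + v * r2"
      have "u * (- a1) \<le> u * r1" "v * (- a2) \<le> v * r2"
        unfolding r1_def r2_def using uv by (intro mult_left_mono; simp)+
      then have r: "norm k < r" "r > 0"
        using k norm_ge_zero[of k] unfolding r_def by linarith+
      have "norm ((\<rho> / r) *\<^sub>R k) < \<rho> \<or> (\<rho> / r) *\<^sub>R k = 0" if "\<rho> \<ge> 0" for \<rho>
      proof (cases "\<rho> = 0")
        case False
        then have "\<rho> * norm k < \<rho> * r" using r that by simp
        then show ?thesis using r that by (simp add: field_simps)
      qed simp
      then have "z1 + (r1 / r) *\<^sub>R k \<in> U" "z2 + (r2 / r) *\<^sub>R k \<in> U"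
        using in1 in2 by (auto simp: r1_def r2_def)
      then have "u *\<^sub>R (z1 + (r1 / r) *\<^sub>R k) + v *\<^sub>R (z2 + (r2 / r) *\<^sub>R k) \<in> U"
        using U(2) uv by (auto simp: convex_def)
      moreover have "u * (r1 / r) + v * (r2 / r) = 1"
        using r unfolding r_def by (simp add: add_divide_distrib[symmetric])
      then have "(u * (r1 / r)) *\<^sub>R k + (v * (r2 / r)) *\<^sub>R k = k"
        by (metis scaleR_left.add scaleR_one)
      ultimately show ?thesis
        by (simp add: algebra_simps)
    qed
    then have "ball (u *\<^sub>R z1 + v *\<^sub>R z2) (- (u * a1 + v * a2)) \<subseteq> U"
    proof (intro subsetI)
      fix y assume y: "y \<in> ball (u *\<^sub>R z1 + v *\<^sub>R z2) (- (u * a1 + v * a2))"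
      assume *: "\<And>k. norm k < u * (- a1) + v * (- a2) \<Longrightarrow> u *\<^sub>R z1 + v *\<^sub>R z2 + k \<in> U"
      show "y \<in> U"
        using *[of "y - (u *\<^sub>R z1 + v *\<^sub>R z2)"] y by (simp add: dist_norm norm_minus_commute)
    qed
    moreover have "u *\<^sub>R z1 + v *\<^sub>R z2 \<in> U"
      using U(2) U12 uv by (auto simp: convex_def)
    ultimately show "u *\<^sub>R e1 + v *\<^sub>R e2 \<in> E"
      by (simp add: E_def e12)
  qed
  \<comment> \<open>Openness of \<open>U\<close> enters here: a point of \<open>E\<close> at
    strictly negative height over each \<open>z\<close> makes the final inequality strict.\<close>
  moreover have pos: "\<exists>r>0. (z, - r) \<in> E" if "z \<in> U" for z
    using U(1) that by (auto simp: E_def open_contains_ball)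
  moreover have "0 - 1 * norm (z - x) \<le> a" if "(z, a) \<in> E" for z a
  proof (rule ccontr)
    assume "\<not> 0 - 1 * norm (z - x) \<le> a"
    then have "x \<in> ball z (- a)"
      by (simp add: dist_norm)
    with that x show False
      by (auto simp: E_def)
  qed
  ultimately obtain p :: "'a \<Rightarrow>\<^sub>L real" where p: "\<And>z a. (z, a) \<in> E \<Longrightarrow> 0 + p (z - x) \<le> a"
    using affine_minorant_of_norm_minorant[of E 1 0 x] U(3) by (metis all_not_in_conv zero_le_one)
  show thesis
  proof (rule that)
    fix z assume "z \<in> U"
    with pos obtain r where "r > 0" "(z, - r) \<in> E" by blast
    with p[of z "- r"] show "p z < p x" by (simp add: blinfun.diff_right)
  qed
qed

text \<open>The infimum of the eventual upper bounds \<open>S u\<close> is the upper limit of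
  \<open>P n u\<close>, a sublinear function of \<open>u\<close> bounded by
  \<open>M * norm u\<close>. A linear functional below it behaves like a weak-star cluster point of
  \<open>P\<close>.\<close>

lemma bounded_blinfun_seq_cluster:
  fixes P :: "nat \<Rightarrow> 'a::real_normed_vector \<Rightarrow>\<^sub>L real"
  assumes M: "\<And>n. norm (P n) \<le> M"
  obtains p :: "'a \<Rightarrow>\<^sub>L real" where "\<And>u s. eventually (\<lambda>n. P n u \<le> s) sequentially \<Longrightarrow> p u \<le> s"
proof -
  define S where "S u = {s. eventually (\<lambda>n. P n u \<le> s) sequentially}" for u
  have normS: "M * norm u \<in> S u" for u
  proof -
    have "P n u \<le> M * norm u" for n
      using norm_blinfun[of "P n" u] mult_right_mono[OF M[of n] norm_ge_zero[of u]] by simp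
    then show ?thesis by (simp add: S_def)
  qed
  have add: "s + t \<in> S (h + k)" if "s \<in> S h" "t \<in> S k" for s t h k
    using that unfolding S_def mem_Collect_eq
    by eventually_elim (simp add: blinfun.add_right)
  have scale: "c * s \<in> S (c *\<^sub>R h)" if "c > 0" "s \<in> S h" for c s h
    using that(2) unfolding S_def mem_Collect_eq
    by eventually_elim (use that(1) in \<open>simp add: blinfun.scaleR_right\<close>)
  have zero: "0 \<le> s" if "s \<in> S 0" for s
    using that by (simp add: S_def)
  obtain F where F: "linear F" "\<And>h s. s \<in> S h \<Longrightarrow> F h \<le> s"
    using hahn_banach_cone[of S, OF _ add scale zero] normS by blast
  obtain p :: "'a \<Rightarrow>\<^sub>L real" where "\<And>h. p h = F h"
    using linear_le_norm_blinfun[OF F(1)] F(2)[OF normS] by blast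
  with F show thesis by (intro that[of p]) (simp add: S_def)
qed

section \<open>Extended real convex functions and their conjugates\<close>

lemma convex_fun_le:
  assumes "convex_fun \<Phi>" "\<Phi> x \<le> ereal a" "\<Phi> y \<le> ereal b" "0 \<le> t" "t \<le> 1"
  shows "\<Phi> ((1 - t) *\<^sub>R x + t *\<^sub>R y) \<le> ereal ((1 - t) * a + t * b)"
proof -
  consider "t = 0" | "t = 1" | "t \<in> {0<..<1}" using assms by fastforce
  then show ?thesis
  proof cases
    case 3
    then have "\<Phi> ((1 - t) *\<^sub>R x + t *\<^sub>R y) \<le> ereal (1 - t) * \<Phi> x + ereal t * \<Phi> y"
      using assms(1) by (simp add: convex_fun_def)
    also have "\<dots> \<le> ereal (1 - t) * ereal a + ereal t * ereal b"
      using assms by (intro add_mono ereal_mult_left_mono) auto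
    finally show ?thesis by simp
  qed (use assms in auto)
qed

lemma convex_epigraph:
  assumes "convex_fun \<Phi>"
  shows "convex {(x, a). \<Phi> x \<le> ereal a}"
  unfolding convex_alt using convex_fun_le[OF assms] by auto

lemma convex_funI:
  assumes "\<And>x. \<Phi> x \<noteq> - \<infinity>"
    and "\<And>x y a b t. \<Phi> x = ereal a \<Longrightarrow> \<Phi> y = ereal b \<Longrightarrow> 0 < t \<Longrightarrow> t < 1 \<Longrightarrow>
      \<Phi> ((1 - t) *\<^sub>R x + t *\<^sub>R y) \<le> ereal ((1 - t) * a + t * b)"
  shows "convex_fun \<Phi>"
  unfolding convex_fun_def
proof (intro allI ballI)
  fix x y and t :: real assume "t \<in> {0<..<1}"
  then show "\<Phi> ((1 - t) *\<^sub>R x + t *\<^sub>R y) \<le> ereal (1 - t) * \<Phi> x + ereal t * \<Phi> y"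
    using assms(1)[of x] assms(1)[of y] assms(2)[of x _ y _ t]
    by (cases "\<Phi> x"; cases "\<Phi> y") auto
qed

lemma mem_edom_iff: "x \<in> edom \<Phi> \<longleftrightarrow> (\<exists>a. \<Phi> x \<le> ereal a)"
  by (cases "\<Phi> x") (auto simp: edom_def)

lemma convex_edom:
  assumes "convex_fun \<Phi>"
  shows "convex (edom \<Phi>)"
  unfolding convex_alt
proof (intro ballI allI impI)
  fix x y and t :: real
  assume "x \<in> edom \<Phi>" "y \<in> edom \<Phi>" "0 \<le> t \<and> t \<le> 1"
  then obtain a b where "\<Phi> x \<le> ereal a" "\<Phi> y \<le> ereal b" "0 \<le> t" "t \<le> 1"
    by (auto simp: mem_edom_iff)
  from convex_fun_le[OF assms this] show "(1 - t) *\<^sub>R x + t *\<^sub>R y \<in> edom \<Phi>"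
    by (auto simp: mem_edom_iff)
qed

text \<open>The affine map sending \<open>v\<close> to
  \<open>(1 - t) *\<^sub>R z + t *\<^sub>R v\<close> carries \<open>interior S\<close> onto an open
  subset of \<open>S\<close>.\<close>

lemma interior_convex_mix:
  fixes S :: "'a::real_normed_vector set"
  assumes "convex S" "u \<in> interior S" "z \<in> S" "0 < t" "t \<le> 1"
  shows "(1 - t) *\<^sub>R z + t *\<^sub>R u \<in> interior S"
proof (rule interiorI)
  show "open ((\<lambda>v. (1 - t) *\<^sub>R z + t *\<^sub>R v) ` interior S)"
    using assms by (intro open_affinity) auto
  show "(\<lambda>v. (1 - t) *\<^sub>R z + t *\<^sub>R v) ` interior S \<subseteq> S"
  proof
    fix y assume "y \<in> (\<lambda>v. (1 - t) *\<^sub>R z + t *\<^sub>R v) ` interior S"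
    then obtain v where "v \<in> S" "y = (1 - t) *\<^sub>R z + t *\<^sub>R v"
      using interior_subset by blast
    then show "y \<in> S"
      using convexD_alt[OF assms(1,3)] assms(4,5) by simp
  qed
qed (use assms in auto)

lemma lower_semicontinuousD:
  fixes \<Phi> :: "'a::metric_space \<Rightarrow> ereal"
  assumes "lower_semicontinuous \<Phi>" "L < \<Phi> x"
  obtains r where "r > 0" "\<And>z. dist z x < r \<Longrightarrow> L < \<Phi> z"
proof -
  have "\<forall>\<^sub>F z in at x. L < \<Phi> z"
    using assms unfolding lower_semicontinuous_def le_Liminf_iff by blast
  then obtain r where "r > 0" "\<And>z. z \<noteq> x \<Longrightarrow> dist z x < r \<Longrightarrow> L < \<Phi> z"
    by (auto simp: eventually_at)
  with assms(2) show thesis by (metis that)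
qed

lemma closed_sublevel:
  fixes \<Phi> :: "'a::metric_space \<Rightarrow> ereal"
  assumes "lower_semicontinuous \<Phi>"
  shows "closed {x. \<Phi> x \<le> c}"
  unfolding closed_def open_dist
proof
  fix x assume "x \<in> - {x. \<Phi> x \<le> c}"
  then have "c < \<Phi> x" by auto
  from lower_semicontinuousD[OF assms this]
  show "\<exists>e>0. \<forall>y. dist y x < e \<longrightarrow> y \<in> - {x. \<Phi> x \<le> c}"
    by (metis ComplI leD mem_Collect_eq)
qed

text \<open>By Baire's theorem one of the closed sublevel sets covering the domain contains a ball.
  Convexity transports the bound from that ball to a neighbourhood of \<open>x\<close>, using a
  domain point on the far side of \<open>x\<close>.\<close>

lemma convex_fun_bounded_near_interior:
  fixes \<Phi> :: "'a::banach \<Rightarrow> ereal"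
  assumes conv: "convex_fun \<Phi>" and closed: "\<And>c. closed {x. \<Phi> x \<le> ereal c}"
    and x: "x \<in> interior (edom \<Phi>)"
  obtains r c where "r > 0" "\<And>z. dist z x < r \<Longrightarrow> \<Phi> z \<le> ereal c"
proof -
  define T where "T n = {z. \<Phi> z \<le> ereal (real n)}" for n
  have "edom \<Phi> \<subseteq> (\<Union>n. T n)"
  proof
    fix z assume "z \<in> edom \<Phi>"
    then have "\<exists>n. \<Phi> z \<le> ereal (real n)"
      by (cases "\<Phi> z") (auto simp: edom_def intro: real_arch_simple)
    then show "z \<in> (\<Union>n. T n)" by (simp add: T_def)
  qed
  then have "interior (\<Union>n. T n) \<noteq> {}"
    using x interior_mono by blast
  then have "\<exists>n. interior (T n) \<noteq> {}"
    using Baire_category_alt[of euclidean "range T"] completely_metrizable_space_euclidean closed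
    by (auto simp: T_def)
  then obtain n w \<rho> where \<rho>: "\<rho> > 0" "ball w \<rho> \<subseteq> T n"
    by (metis all_not_in_conv mem_interior)
  obtain \<delta> where \<delta>: "\<delta> > 0" "ball x \<delta> \<subseteq> edom \<Phi>"
    using x by (auto simp: mem_interior)
  define N where "N = norm (x - w)"
  have N: "N \<ge> 0" by (simp add: N_def)
  \<comment> \<open>So small that prolonging the segment from \<open>w\<close> through
    \<open>x\<close> by the factor \<open>s\<close> stays within distance \<open>\<delta>\<close> of
    \<open>x\<close>.\<close>
  define s where "s = \<delta> / (2 * (1 + N))"
  have s: "s > 0" using \<delta> N by (simp add: s_def)
  have "s * N < s * (2 * (1 + N))"
    using s N by (intro mult_strict_left_mono) auto
  also have "\<dots> = \<delta>"
    using N by (simp add: s_def)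
  finally have "x + s *\<^sub>R (x - w) \<in> ball x \<delta>"
    using s by (simp add: dist_norm N_def)
  then obtain b where b: "\<Phi> (x + s *\<^sub>R (x - w)) \<le> ereal b"
    using \<delta>(2) mem_edom_iff by (metis subsetD)
  \<comment> \<open>With this weight \<open>x\<close> is the mixture of the prolonged point and
    \<open>w\<close>. Replacing \<open>w\<close> by a point \<open>v\<close> of the ball around it
    then reaches every \<open>z\<close> within \<open>t * \<rho>\<close> of
    \<open>x\<close>.\<close>
  define t where "t = s / (1 + s)"
  have t: "0 < t" "t < 1" "1 - t = 1 / (1 + s)" using s by (auto simp: t_def field_simps)
  have "\<Phi> z \<le> ereal ((1 - t) * b + t * real n)" if "dist z x < t * \<rho>" for z
  proof -
    define v where "v = w + (1 / t) *\<^sub>R (z - x)"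
    have "v \<in> ball w \<rho>"
    proof -
      have "dist w v = dist z x / t"
        using t by (simp add: v_def dist_norm)
      with \<open>dist z x < t * \<rho>\<close> t(1) show ?thesis
        by (simp add: pos_divide_less_eq mult.commute)
    qed
    then have "\<Phi> v \<le> ereal (real n)"
      using \<rho> by (auto simp: T_def)
    then have "\<Phi> ((1 - t) *\<^sub>R (x + s *\<^sub>R (x - w)) + t *\<^sub>R v) \<le> ereal ((1 - t) * b + t * real n)"
      using t by (intro convex_fun_le conv b) auto
    moreover have ts: "(1 - t) * s = t" unfolding t(3) by (simp add: t_def)
    have "(1 - t) *\<^sub>R (x + s *\<^sub>R (x - w)) + t *\<^sub>R v = (1 - t) *\<^sub>R x + t *\<^sub>R (x - w) + t *\<^sub>R v"
      by (simp only: scaleR_add_right scaleR_scaleR ts)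
    then have "(1 - t) *\<^sub>R (x + s *\<^sub>R (x - w)) + t *\<^sub>R v = z"
      using t(1) by (simp add: v_def scaleR_add_right scaleR_diff_right scaleR_diff_left)
    ultimately show ?thesis by simp
  qed
  with that[of "t * \<rho>"] t \<rho> show thesis by auto
qed

section \<open>Subgradients\<close>

lemma subdifferentialI:
  assumes "\<Phi> x = ereal a" "\<And>z b. \<Phi> z \<le> ereal b \<Longrightarrow> a + blinfun_apply p (z - x) \<le> b"
  shows "p \<in> subdifferential \<Phi> x"
  unfolding subdifferential_def
proof (intro CollectI allI)
  fix z
  \<comment> \<open>The second instance, with a bound one below the required value, excludes
    \<open>\<Phi> z = -\<infinity>\<close>.\<close>
  show "\<Phi> x + ereal (p (z - x)) \<le> \<Phi> z"
    using assms(1) assms(2)[of z "real_of_ereal (\<Phi> z)"] assms(2)[of z "a + p (z - x) - 1"]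
    by (cases "\<Phi> z") auto
qed

lemma subdifferentialD:
  assumes "p \<in> subdifferential \<Phi> x" "\<Phi> x = ereal a" "\<Phi> z \<le> ereal b"
  shows "a + p (z - x) \<le> b"
proof -
  have "\<Phi> x + ereal (p (z - x)) \<le> \<Phi> z"
    using assms(1) by (simp add: subdifferential_def)
  also note assms(3)
  finally show ?thesis by (simp add: assms(2))
qed

lemma subdifferential_finite:
  assumes "proper \<Phi>" "p \<in> subdifferential \<Phi> x"
  obtains a where "\<Phi> x = ereal a"
proof -
  obtain z where "\<Phi> z \<noteq> \<infinity>" using assms by (auto simp: proper_def edom_def)
  moreover have "\<Phi> x + ereal (p (z - x)) \<le> \<Phi> z"
    using assms by (simp add: subdifferential_def)
  ultimately have "\<Phi> x \<noteq> \<infinity>" by auto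
  then show thesis using assms(1) that by (cases "\<Phi> x") (auto simp: proper_def)
qed

text \<open>An upper bound near \<open>y\<close> becomes a lower bound everywhere: reflecting
  \<open>z\<close> through \<open>y\<close> into the ball and using convexity shows that
  \<open>\<Phi>\<close> stays above \<open>a - M * norm (z - y)\<close>, and this minorant can be
  replaced by an affine one.\<close>

lemma subdifferential_nonempty:
  fixes \<Phi> :: "'a::real_normed_vector \<Rightarrow> ereal"
  assumes conv: "convex_fun \<Phi>" and y: "\<Phi> y = ereal a"
    and r: "r > 0" "\<And>z. dist z y < r \<Longrightarrow> \<Phi> z \<le> ereal c"
  shows "subdifferential \<Phi> y \<noteq> {}"
proof -
  have "a \<le> c" using r(2)[of y] y r(1) by simp
  define M where "M = 2 * (c - a) / r"
  have "a - M * norm (z - y) \<le> b" if zb: "(z, b) \<in> {(x, a). \<Phi> x \<le> ereal a}" for z b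
  proof (cases "z = y")
    case True
    then show ?thesis using zb y by simp
  next
    case False
    \<comment> \<open>The reflected point \<open>y - k *\<^sub>R (z - y)\<close> has distance
      \<open>r / 2\<close> from \<open>y\<close>, and the weight \<open>t\<close> makes
      \<open>y\<close> its mixture with \<open>z\<close>.\<close>
    define k where "k = r / (2 * norm (z - y))"
    define t where "t = k / (1 + k)"
    have k: "k > 0" using False r by (simp add: k_def)
    have t: "0 < t" "t < 1" "1 - t = 1 / (1 + k)" using k by (auto simp: t_def field_simps)
    have "\<Phi> (y - k *\<^sub>R (z - y)) \<le> ereal c"
      using False r(1) by (intro r(2)) (simp add: dist_norm k_def)
    then have "\<Phi> ((1 - t) *\<^sub>R (y - k *\<^sub>R (z - y)) + t *\<^sub>R z) \<le> ereal ((1 - t) * c + t * b)"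
      using zb t by (intro convex_fun_le conv) auto
    moreover have tk: "(1 - t) * k = t" unfolding t(3) by (simp add: t_def)
    have "(1 - t) *\<^sub>R (y - k *\<^sub>R (z - y)) + t *\<^sub>R z = (1 - t) *\<^sub>R y - t *\<^sub>R (z - y) + t *\<^sub>R z"
      by (simp only: scaleR_diff_right scaleR_scaleR tk)
    then have "(1 - t) *\<^sub>R (y - k *\<^sub>R (z - y)) + t *\<^sub>R z = y"
      by (simp add: scaleR_diff_right scaleR_diff_left)
    ultimately have "a \<le> (1 - t) * c + t * b" using y by simp
    then have "(1 + k) * a \<le> (1 + k) * ((1 - t) * c + t * b)"
      using k by simp
    also have "\<dots> = ((1 + k) * (1 - t)) * c + ((1 + k) * t) * b"
      by (simp only: distrib_left mult.assoc)
    also have "\<dots> = c + k * b"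
      unfolding t(3) using k by (simp add: t_def)
    finally have "k * (a - b) \<le> c - a" by (simp add: algebra_simps)
    then have "a - b \<le> (c - a) / k" using k by (simp add: field_simps)
    also have "\<dots> = M * norm (z - y)" by (simp add: M_def k_def)
    finally show ?thesis by simp
  qed
  moreover have "M \<ge> 0" using \<open>a \<le> c\<close> r by (simp add: M_def)
  moreover have "(y, a) \<in> {(x, a). \<Phi> x \<le> ereal a}" using y by simp
  then have "{(x, a). \<Phi> x \<le> ereal a} \<noteq> {}" by (metis empty_iff)
  ultimately obtain p :: "'a \<Rightarrow>\<^sub>L real"
    where "\<And>z b. (z, b) \<in> {(x, a). \<Phi> x \<le> ereal a} \<Longrightarrow> a + p (z - y) \<le> b"
    using affine_minorant_of_norm_minorant[OF convex_epigraph[OF conv]] by metis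
  then have "p \<in> subdifferential \<Phi> y"
    by (intro subdifferentialI[of _ _ a] y) auto
  then show ?thesis by blast
qed

section \<open>Gateaux derivatives of convex functions\<close>

lemma gateaux_deriv_eq:
  assumes "has_gateaux_deriv \<Phi> f x"
  shows "gateaux_deriv \<Phi> x = f"
  unfolding gateaux_deriv_def
proof (rule the_equality)
  show "has_gateaux_deriv \<Phi> f x" by fact
next
  fix g assume "has_gateaux_deriv \<Phi> g x"
  then have "ereal (g h) = ereal (f h)" for h
    using assms unfolding has_gateaux_deriv_def by (meson tendsto_unique trivial_limit_at)
  then show "g = f" by (intro blinfun_eqI) simp
qed

lemma has_gateaux_deriv_at_right:
  assumes "has_gateaux_deriv \<Phi> f x"
  shows "((\<lambda>t. (\<Phi> (x + t *\<^sub>R h) - \<Phi> x) / ereal t) \<longlongrightarrow> ereal (f h)) (at_right 0)"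
  using assms unfolding has_gateaux_deriv_def by (meson filterlim_at_split)

lemma gateaux_deriv_ge:
  assumes "has_gateaux_deriv \<Phi> f x" "\<Phi> x = ereal a"
    and le: "\<And>t. 0 < t \<Longrightarrow> t < 1 \<Longrightarrow> ereal (a + t * c) \<le> \<Phi> (x + t *\<^sub>R h)"
  shows "c \<le> f h"
proof -
  have "\<forall>\<^sub>F t in at_right 0. ereal c \<le> (\<Phi> (x + t *\<^sub>R h) - \<Phi> x) / ereal t"
    using eventually_at_right_less[of "0::real"] eventually_at_right_real[OF zero_less_one]
  proof eventually_elim
    case (elim t)
    then show ?case
      using le[of t] assms(2) by (cases "\<Phi> (x + t *\<^sub>R h)") (auto simp: field_simps)
  qed
  from tendsto_lowerbound[OF has_gateaux_deriv_at_right[OF assms(1)] this]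
  show ?thesis by simp
qed

lemma gateaux_deriv_le:
  assumes "has_gateaux_deriv \<Phi> f x" "\<Phi> x = ereal a"
    and le: "\<And>t. 0 < t \<Longrightarrow> t < 1 \<Longrightarrow> \<Phi> (x + t *\<^sub>R h) \<le> ereal (a + t * c)"
  shows "f h \<le> c"
proof -
  have "\<forall>\<^sub>F t in at_right 0. (\<Phi> (x + t *\<^sub>R h) - \<Phi> x) / ereal t \<le> ereal c"
    using eventually_at_right_less[of "0::real"] eventually_at_right_real[OF zero_less_one]
  proof eventually_elim
    case (elim t)
    then show ?case
      using le[of t] assms(2) by (cases "\<Phi> (x + t *\<^sub>R h)") (auto simp: field_simps)
  qed
  from tendsto_upperbound[OF has_gateaux_deriv_at_right[OF assms(1)] this]
  show ?thesis by simp
qed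

lemma gateaux_deriv_subgradient:
  assumes conv: "convex_fun \<Phi>" and f: "has_gateaux_deriv \<Phi> f x" "\<Phi> x = ereal a"
  shows "f \<in> subdifferential \<Phi> x"
proof (rule subdifferentialI[of _ _ a])
  fix z b assume b: "\<Phi> z \<le> ereal b"
  have "f (z - x) \<le> b - a"
  proof (rule gateaux_deriv_le[OF f])
    fix t :: real assume "0 < t" "t < 1"
    then have "\<Phi> ((1 - t) *\<^sub>R x + t *\<^sub>R z) \<le> ereal ((1 - t) * a + t * b)"
      using b f(2) by (intro convex_fun_le conv) auto
    then show "\<Phi> (x + t *\<^sub>R (z - x)) \<le> ereal (a + t * (b - a))"
      by (simp add: algebra_simps)
  qed
  then show "a + f (z - x) \<le> b" by simp
qed (use f in auto)

text \<open>A subgradient lies below the derivative in every direction; the directions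
  \<open>h\<close> and \<open>- h\<close> together force equality.\<close>

lemma subgradient_eq_gateaux_deriv:
  assumes p: "p \<in> subdifferential \<Phi> x" and f: "has_gateaux_deriv \<Phi> f x" "\<Phi> x = ereal a"
  shows "p = f"
proof (rule blinfun_eqI)
  have le: "p h \<le> f h" for h
  proof (rule gateaux_deriv_ge[OF f])
    fix t :: real
    have "\<Phi> x + ereal (p (x + t *\<^sub>R h - x)) \<le> \<Phi> (x + t *\<^sub>R h)"
      using p unfolding subdifferential_def by blast
    then show "ereal (a + t * p h) \<le> \<Phi> (x + t *\<^sub>R h)"
      using f(2) by (simp add: blinfun.scaleR_right)
  qed
  show "p h = f h" for h
    using le[of h] le[of "- h"] by (simp add: blinfun.minus_right)
qed

section \<open>Conjugation and biduality\<close>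

definition eval_blinfun :: "'a::real_normed_vector \<Rightarrow> ('a \<Rightarrow>\<^sub>L real) \<Rightarrow>\<^sub>L real" where
  "eval_blinfun x = Blinfun (\<lambda>p. blinfun_apply p x)"

lemma eval_blinfun_apply [simp]: "blinfun_apply (eval_blinfun x) p = blinfun_apply p x"
  by (simp add: eval_blinfun_def bounded_linear_Blinfun_apply blinfun.bounded_linear_left)

lemma conjugate_ge:
  assumes "\<Phi> x \<le> ereal a"
  shows "ereal (blinfun_apply p x - a) \<le> conjugate \<Phi> p"
proof -
  have "ereal (p x - a) \<le> ereal (p x) - \<Phi> x"
    using assms by (cases "\<Phi> x") auto
  also have "\<dots> \<le> conjugate \<Phi> p"
    unfolding conjugate_def by (rule SUP_upper) simp
  finally show ?thesis .
qed

text \<open>Quantifying over real upper bounds \<open>a\<close> of \<open>\<Phi> x\<close> turns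
  extended subtraction into real arithmetic. Convexity of the conjugate and closedness of its
  sublevel sets are read off from this form.\<close>

lemma conjugate_le_iff:
  "conjugate \<Phi> p \<le> ereal c \<longleftrightarrow> (\<forall>x a. \<Phi> x \<le> ereal a \<longrightarrow> blinfun_apply p x - a \<le> c)"
proof
  show "conjugate \<Phi> p \<le> ereal c \<Longrightarrow> \<forall>x a. \<Phi> x \<le> ereal a \<longrightarrow> blinfun_apply p x - a \<le> c"
    using conjugate_ge[of \<Phi>] by (metis ereal_less_eq(3) order_trans)
next
  assume *: "\<forall>x a. \<Phi> x \<le> ereal a \<longrightarrow> blinfun_apply p x - a \<le> c"
  show "conjugate \<Phi> p \<le> ereal c"
    unfolding conjugate_def
  proof (rule SUP_least)
    fix x
    show "ereal (p x) - \<Phi> x \<le> ereal c"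
      using *[rule_format, of x "real_of_ereal (\<Phi> x)"] *[rule_format, of x "p x - c - 1"]
      by (cases "\<Phi> x") auto
  qed
qed

lemma conjugate_leD:
  assumes "conjugate \<Phi> p \<le> ereal c" "\<Phi> x \<le> ereal a"
  shows "blinfun_apply p x - a \<le> c"
  using assms by (simp add: conjugate_le_iff)

lemma conjugate_not_minus_infinity:
  assumes "proper \<Phi>"
  shows "conjugate \<Phi> p \<noteq> - \<infinity>"
proof -
  obtain x where "\<Phi> x \<noteq> \<infinity>" "\<Phi> x \<noteq> - \<infinity>"
    using assms by (auto simp: proper_def edom_def)
  then have "\<Phi> x \<le> ereal (real_of_ereal (\<Phi> x))"
    by (cases "\<Phi> x") auto
  from conjugate_ge[of \<Phi> x, OF this, of p] show ?thesis by auto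
qed

lemma convex_fun_conjugate:
  assumes "proper \<Phi>"
  shows "convex_fun (conjugate \<Phi>)"
proof (rule convex_funI)
  fix p q a b and t :: real
  assume "conjugate \<Phi> p = ereal a" "conjugate \<Phi> q = ereal b" and t: "0 < t" "t < 1"
  then have *: "\<forall>x c. \<Phi> x \<le> ereal c \<longrightarrow> p x - c \<le> a" "\<forall>x c. \<Phi> x \<le> ereal c \<longrightarrow> q x - c \<le> b"
    by (metis conjugate_le_iff order_refl)+
  show "conjugate \<Phi> ((1 - t) *\<^sub>R p + t *\<^sub>R q) \<le> ereal ((1 - t) * a + t * b)"
    unfolding conjugate_le_iff
  proof (intro allI impI)
    fix x c assume "\<Phi> x \<le> ereal c"
    then have "(1 - t) * (p x - c) + t * (q x - c) \<le> (1 - t) * a + t * b"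
      using * t by (intro add_mono mult_left_mono) auto
    then show "((1 - t) *\<^sub>R p + t *\<^sub>R q) x - c \<le> (1 - t) * a + t * b"
      by (simp only: blinfun.add_left blinfun.scaleR_left) (simp add: algebra_simps)
  qed
qed (rule conjugate_not_minus_infinity[OF assms])

lemma closed_sublevel_conjugate: "closed {p. conjugate \<Phi> p \<le> ereal c}"
proof -
  have "closed {p. \<forall>x a. \<Phi> x \<le> ereal a \<longrightarrow> blinfun_apply p x - a \<le> c}"
    by (intro closed_Collect_all closed_Collect_imp closed_Collect_le open_Collect_const
        continuous_intros)
  then show ?thesis by (simp add: conjugate_le_iff)
qed

lemma conjugate_subgradient:
  assumes "p \<in> subdifferential \<Phi> x" "\<Phi> x = ereal a"
  shows "conjugate \<Phi> p = ereal (p x - a)"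
proof (rule antisym)
  show "conjugate \<Phi> p \<le> ereal (p x - a)"
    unfolding conjugate_le_iff
  proof (intro allI impI)
    fix z b assume "\<Phi> z \<le> ereal b"
    from subdifferentialD[OF assms this] show "p z - b \<le> p x - a"
      by (simp add: blinfun.diff_right)
  qed
next
  show "ereal (p x - a) \<le> conjugate \<Phi> p"
    by (rule conjugate_ge) (simp add: assms(2))
qed

lemma eval_in_subdifferential_conjugate:
  assumes "p \<in> subdifferential \<Phi> x" "\<Phi> x = ereal a"
  shows "eval_blinfun x \<in> subdifferential (conjugate \<Phi>) p"
proof (rule subdifferentialI)
  show "conjugate \<Phi> p = ereal (p x - a)" by (rule conjugate_subgradient[OF assms])
  fix q b assume "conjugate \<Phi> q \<le> ereal b"
  then have "q x - a \<le> b" using assms(2) by (auto simp: conjugate_le_iff)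
  then show "p x - a + eval_blinfun x (q - p) \<le> b" by (simp add: blinfun.diff_left)
qed

text \<open>This is the nontrivial half of biconjugation: \<open>\<Phi>\<close> has an affine
  minorant of value \<open>L\<close> at \<open>x\<close>. Near \<open>x\<close> lower semicontinuity
  keeps \<open>\<Phi>\<close> above \<open>L\<close>; far away the minorant \<open>f0 - c0\<close>
  keeps it above a steep cone.\<close>

lemma fenchel_moreau:
  fixes \<Phi> :: "'a::real_normed_vector \<Rightarrow> ereal"
  assumes \<Phi>: "\<Phi> \<in> Gamma" and f0: "conjugate \<Phi> f0 \<le> ereal c0" and L: "ereal L < \<Phi> x"
  obtains q where "conjugate \<Phi> q \<le> ereal (q x - L)"
proof -
  have conv: "convex_fun \<Phi>" and lsc: "lower_semicontinuous \<Phi>" and "proper \<Phi>"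
    using \<Phi> by (auto simp: Gamma_def)
  have f0: "f0 z - c0 \<le> b" if "\<Phi> z \<le> ereal b" for z b
    using conjugate_leD[OF f0 that] by simp
  obtain r where r: "r > 0" "\<And>z. dist z x < r \<Longrightarrow> ereal L < \<Phi> z"
    using lower_semicontinuousD[OF lsc L] by blast
  \<comment> \<open>The second summand absorbs the gap between \<open>L\<close> and
    \<open>f0 x - c0\<close> as soon as \<open>norm (z - x)\<close> is at least
    \<open>r\<close>.\<close>
  define M where "M = norm f0 + \<bar>L - f0 x + c0\<bar> / r"
  have M: "M \<ge> 0" using r by (simp add: M_def)
  have "L - M * norm (z - x) \<le> b" if "(z, b) \<in> {(x, a). \<Phi> x \<le> ereal a}" for z b
  proof (cases "dist z x < r")
    case True
    then have "L < b" using r(2)[of z] that by (auto dest: less_le_trans)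
    moreover have "0 \<le> M * norm (z - x)" using M by simp
    ultimately show ?thesis by linarith
  next
    case False
    then have "1 * r \<le> norm (z - x)" by (simp add: dist_norm)
    then have "1 \<le> norm (z - x) / r" using r by (simp add: field_simps)
    then have "\<bar>L - f0 x + c0\<bar> * 1 \<le> \<bar>L - f0 x + c0\<bar> * (norm (z - x) / r)"
      by (rule mult_left_mono) simp
    then have "L - f0 x + c0 \<le> (M - norm f0) * norm (z - x)"
      by (simp add: M_def)
    moreover have "- (norm f0 * norm (z - x)) \<le> f0 (z - x)"
      using norm_blinfun[of f0 "z - x"] by (simp add: abs_le_iff)
    ultimately show ?thesis
      using f0[of z b] that by (simp add: blinfun.diff_right algebra_simps)
  qed
  moreover have "{(x, a). \<Phi> x \<le> ereal a} \<noteq> {}"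
  proof -
    obtain z where "\<Phi> z \<noteq> \<infinity>" using \<open>proper \<Phi>\<close> by (auto simp: proper_def edom_def)
    then have "(z, real_of_ereal (\<Phi> z)) \<in> {(x, a). \<Phi> x \<le> ereal a}" by (cases "\<Phi> z") auto
    then show ?thesis by (metis empty_iff)
  qed
  ultimately obtain q :: "'a \<Rightarrow>\<^sub>L real"
    where q: "\<And>z b. (z, b) \<in> {(x, a). \<Phi> x \<le> ereal a} \<Longrightarrow> L + q (z - x) \<le> b"
    using affine_minorant_of_norm_minorant[OF convex_epigraph[OF conv] _ M] by metis
  have "conjugate \<Phi> q \<le> ereal (q x - L)"
    unfolding conjugate_le_iff
  proof (intro allI impI)
    fix z b assume "\<Phi> z \<le> ereal b"
    with q[of z b] show "q z - b \<le> q x - L"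
      by (simp add: blinfun.diff_right)
  qed
  then show thesis by (rule that)
qed

text \<open>Testing the subgradient inequality of the conjugate at the slopes from
  \<open>fenchel_moreau\<close> gives \<open>\<Phi> x \<le> p x - b\<close>. This is equality in
  Young's inequality, which is symmetric in \<open>x\<close> and \<open>p\<close>.\<close>

lemma subgradient_of_eval_in_subdifferential_conjugate:
  fixes \<Phi> :: "'a::real_normed_vector \<Rightarrow> ereal"
  assumes \<Phi>: "\<Phi> \<in> Gamma" and x: "eval_blinfun x \<in> subdifferential (conjugate \<Phi>) p"
    and b: "conjugate \<Phi> p = ereal b"
  shows "p \<in> subdifferential \<Phi> x"
proof -
  have le: "L \<le> p x - b" if L: "ereal L < \<Phi> x" for L
  proof -
    obtain q where "conjugate \<Phi> q \<le> ereal (q x - L)"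
      using fenchel_moreau[OF \<Phi> _ L] b by (metis order_refl)
    from subdifferentialD[OF x b this] show ?thesis by (simp add: blinfun.diff_left)
  qed
  have "\<Phi> x \<noteq> - \<infinity>" using \<Phi> by (auto simp: Gamma_def proper_def)
  moreover have "\<Phi> x \<noteq> \<infinity>" using le[of "p x - b + 1"] by auto
  ultimately obtain a where a: "\<Phi> x = ereal a" by (cases "\<Phi> x") auto
  have "a \<le> p x - b" 
  proof (rule dense_le)
    show "L \<le> p x - b" if "L < a" for L
      using le[of L] a that by simp
  qed
  show ?thesis
  proof (rule subdifferentialI)
    show "\<Phi> x = ereal a" by fact
    fix z c assume "\<Phi> z \<le> ereal c"
    then have "p z - c \<le> b"
      using b by (intro conjugate_leD[of \<Phi>]) auto
    then show "a + p (z - x) \<le> c" using \<open>a \<le> p x - b\<close> by (simp add: blinfun.diff_right)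
  qed
qed

text \<open>If strictness fails at \<open>t\<close>, then \<open>\<Phi>\<close> is affine from
  \<open>x\<close> up to that point, so the right derivative towards \<open>y\<close> is
  \<open>b - a\<close>. The gap at \<open>y\<close> then vanishes, against the positive infimum over
  the sphere of radius \<open>norm (y - x)\<close>.\<close>

lemma totally_convex_imp_strictly_convex:
  assumes conv: "convex_fun \<Phi>" and fin: "\<And>x. \<Phi> x \<noteq> - \<infinity>"
    and tot: "totally_convex_on (edom \<Phi>) \<Phi>"
  shows "strictly_convex_fun_on (edom \<Phi>) \<Phi>"
  unfolding strictly_convex_fun_on_def
proof (intro ballI impI)
  fix x y and t :: real
  assume x: "x \<in> edom \<Phi>" and y: "y \<in> edom \<Phi>" and t: "t \<in> {0<..<1}" and "x \<noteq> y"
  obtain a b where a: "\<Phi> x = ereal a" and b: "\<Phi> y = ereal b"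
    using x y fin[of x] fin[of y] by (cases "\<Phi> x"; cases "\<Phi> y") (auto simp: edom_def)
  show "\<Phi> ((1 - t) *\<^sub>R x + t *\<^sub>R y) < ereal (1 - t) * \<Phi> x + ereal t * \<Phi> y"
  proof (rule ccontr)
    assume "\<not> ?thesis"
    then have ge: "ereal ((1 - t) * a + t * b) \<le> \<Phi> ((1 - t) *\<^sub>R x + t *\<^sub>R y)"
      by (simp add: a b)
    have eq: "\<Phi> (x + s *\<^sub>R (y - x)) = ereal (a + s * (b - a))" if s: "0 < s" "s < t" for s
    proof (rule antisym)
      have "\<Phi> ((1 - s) *\<^sub>R x + s *\<^sub>R y) \<le> ereal ((1 - s) * a + s * b)"
        using s t a b by (intro convex_fun_le conv) auto
      then show le: "\<Phi> (x + s *\<^sub>R (y - x)) \<le> ereal (a + s * (b - a))"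
        by (simp add: algebra_simps)
      then obtain c where c: "\<Phi> (x + s *\<^sub>R (y - x)) = ereal c"
        using fin[of "x + s *\<^sub>R (y - x)"] by (cases "\<Phi> (x + s *\<^sub>R (y - x))") auto
      \<comment> \<open>With this weight the point at parameter \<open>t\<close> is the mixture of
        the point at parameter \<open>s\<close> and \<open>y\<close>.\<close>
      define r where "r = (t - s) / (1 - s)"
      have r: "0 \<le> r" "r \<le> 1" "(1 - r) * (1 - s) = 1 - t"
        using s t by (auto simp: r_def divide_simps)
      then have rs: "(1 - r) * s + r = t" by (simp add: algebra_simps)
      have "\<Phi> ((1 - r) *\<^sub>R (x + s *\<^sub>R (y - x)) + r *\<^sub>R y) \<le> ereal ((1 - r) * c + r * b)"
        using r c b by (intro convex_fun_le conv) auto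
      moreover have "(1 - r) *\<^sub>R (x + s *\<^sub>R (y - x)) + r *\<^sub>R y
          = ((1 - r) * (1 - s)) *\<^sub>R x + ((1 - r) * s + r) *\<^sub>R y"
        by (simp add: algebra_simps)
      ultimately have "\<Phi> ((1 - t) *\<^sub>R x + t *\<^sub>R y) \<le> ereal ((1 - r) * c + r * b)"
        by (simp only: r(3) rs)
      with ge have "ereal ((1 - t) * a + t * b) \<le> ereal ((1 - r) * c + r * b)"
        by (rule order_trans)
      then have "((1 - r) * (1 - s)) * a + ((1 - r) * s + r) * b \<le> (1 - r) * c + r * b"
        by (simp add: r(3) rs)
      then have "(1 - r) * ((1 - s) * a + s * b) \<le> (1 - r) * c"
        by (simp add: algebra_simps)
      moreover have "1 - r > 0" using s t by (simp add: r_def divide_simps)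
      ultimately have "(1 - s) * a + s * b \<le> c" by simp
      then show "ereal (a + s * (b - a)) \<le> \<Phi> (x + s *\<^sub>R (y - x))"
        unfolding c by (simp add: algebra_simps)
    qed
    have "\<forall>\<^sub>F s in at_right 0. s \<in> {0<..<t}"
      using t by (intro eventually_at_right_real) auto
    then have "\<forall>\<^sub>F s in at_right 0. (\<Phi> (x + s *\<^sub>R (y - x)) - \<Phi> x) / ereal s = ereal (b - a)"
      by eventually_elim (auto simp: eq a)
    then have "((\<lambda>s. (\<Phi> (x + s *\<^sub>R (y - x)) - \<Phi> x) / ereal s) \<longlongrightarrow> ereal (b - a)) (at_right 0)"
      by (rule tendsto_eventually)
    then have "right_deriv \<Phi> x (y - x) = ereal (b - a)"
      unfolding right_deriv_def by (intro tendsto_Lim) auto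
    then have "\<Phi> y - \<Phi> x - right_deriv \<Phi> x (y - x) = 0"
      by (simp add: a b)
    then have "(INF z\<in>{z\<in>edom \<Phi>. norm (z - x) = norm (y - x)}.
        \<Phi> z - \<Phi> x - right_deriv \<Phi> x (z - x)) \<le> 0"
      using y by (metis (mono_tags, lifting) INF_lower mem_Collect_eq)
    moreover have "0 < norm (y - x)" using \<open>x \<noteq> y\<close> by simp
    ultimately show False
      using tot x unfolding totally_convex_on_def totally_convex_at_def by (meson leD)
  qed
qed

lemma strictly_convex_fun_on_subset:
  "strictly_convex_fun_on T \<Phi> \<Longrightarrow> S \<subseteq> T \<Longrightarrow> strictly_convex_fun_on S \<Phi>"
  unfolding strictly_convex_fun_on_def by blast

lemma dom_subdifferential_subset_edom:
  assumes "proper \<Phi>"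
  shows "dom_subdifferential \<Phi> \<subseteq> edom \<Phi>"
proof
  fix x assume "x \<in> dom_subdifferential \<Phi>"
  then obtain p where "p \<in> subdifferential \<Phi> x" by (auto simp: dom_subdifferential_def)
  then obtain a where "\<Phi> x = ereal a" by (rule subdifferential_finite[OF assms])
  then show "x \<in> edom \<Phi>" by (simp add: edom_def)
qed

lemma convex_subdifferential:
  assumes "\<Phi> x = ereal a"
  shows "convex (subdifferential \<Phi> x)"
  unfolding convex_alt
proof (intro ballI allI impI)
  fix p q and t :: real
  assume pq: "p \<in> subdifferential \<Phi> x" "q \<in> subdifferential \<Phi> x" and t: "0 \<le> t \<and> t \<le> 1"
  show "(1 - t) *\<^sub>R p + t *\<^sub>R q \<in> subdifferential \<Phi> x"
  proof (rule subdifferentialI)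
    show "\<Phi> x = ereal a" by fact
    fix z b assume z: "\<Phi> z \<le> ereal b"
    have "(1 - t) * (a + p (z - x)) + t * (a + q (z - x)) \<le> (1 - t) * b + t * b"
      using subdifferentialD[OF pq(1) assms z] subdifferentialD[OF pq(2) assms z] t
      by (intro add_mono mult_left_mono) auto
    then show "a + ((1 - t) *\<^sub>R p + t *\<^sub>R q) (z - x) \<le> b"
      by (simp only: blinfun.add_left blinfun.scaleR_left) (simp add: algebra_simps)
  qed
qed

section \<open>Right projections\<close>

text \<open>The last assumption is the common consequence of the three cases (a), (b) and (c).\<close>

locale dually_strictly_convex =
  fixes \<Psi> :: "'a::banach \<Rightarrow> ereal"
  assumes reflexive: "reflexive_space TYPE('a)"
    and \<Psi>_Gamma_G: "\<Psi> \<in> Gamma_G"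
    and conj_gateaux:
      "gateaux_differentiable_on (conjugate \<Psi>) (gateaux_deriv \<Psi> ` interior (edom \<Psi>))"
    and deriv_in_interior:
      "gateaux_deriv \<Psi> ` interior (edom \<Psi>) \<subseteq> interior (edom (conjugate \<Psi>))"
    and conj_strictly_convex:
      "convex S \<Longrightarrow> S \<subseteq> dom_subdifferential (conjugate \<Psi>) \<Longrightarrow>
        strictly_convex_fun_on S (conjugate \<Psi>)"
begin

abbreviation "U \<equiv> interior (edom \<Psi>)"
abbreviation "D \<equiv> gateaux_deriv \<Psi>"

section \<open>The derivative and its inverse on the dual side\<close>

lemma \<Psi>_Gamma: "\<Psi> \<in> Gamma" and \<Psi>_proper: "proper \<Psi>" and \<Psi>_convex: "convex_fun \<Psi>"
  and \<Psi>_lsc: "lower_semicontinuous \<Psi>" and U_nonempty: "U \<noteq> {}"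
  and \<Psi>_gateaux: "gateaux_differentiable_on \<Psi> U"
  using \<Psi>_Gamma_G by (auto simp: Gamma_G_def Gamma_def)

lemma \<Psi>_not_minus_infinity: "\<Psi> x \<noteq> - \<infinity>"
  using \<Psi>_proper by (simp add: proper_def)

lemma convex_U: "convex U"
  unfolding convex_alt
proof (intro ballI allI impI)
  fix x y and t :: real
  assume xy: "x \<in> U" "y \<in> U" and t: "0 \<le> t \<and> t \<le> 1"
  show "(1 - t) *\<^sub>R x + t *\<^sub>R y \<in> U"
  proof (cases "t = 0")
    case False
    have "x \<in> edom \<Psi>" using xy(1) interior_subset by blast
    then show ?thesis
      using False t by (intro interior_convex_mix[OF convex_edom[OF \<Psi>_convex] xy(2)]) auto
  qed (use xy in simp)
qed

lemma \<Psi>_finite: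
  assumes "x \<in> U"
  obtains a where "\<Psi> x = ereal a"
  using assms interior_subset \<Psi>_not_minus_infinity[of x]
  by (cases "\<Psi> x") (auto simp: edom_def subset_iff)

lemma D_deriv: "x \<in> U \<Longrightarrow> has_gateaux_deriv \<Psi> (D x) x"
  using \<Psi>_gateaux gateaux_deriv_eq by (metis gateaux_differentiable_on_def)

lemma D_subgradient: "x \<in> U \<Longrightarrow> D x \<in> subdifferential \<Psi> x"
  by (metis D_deriv \<Psi>_finite gateaux_deriv_subgradient[OF \<Psi>_convex])

lemma D_unique: "x \<in> U \<Longrightarrow> p \<in> subdifferential \<Psi> x \<Longrightarrow> p = D x"
  by (metis D_deriv \<Psi>_finite subgradient_eq_gateaux_deriv)

lemma bidual_eval:
  fixes F :: "('a \<Rightarrow>\<^sub>L real) \<Rightarrow>\<^sub>L real"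
  obtains x where "F = eval_blinfun x"
  using reflexive unfolding reflexive_space_def by (metis blinfun_eqI eval_blinfun_apply)

lemma conj_D: "x \<in> U \<Longrightarrow> \<Psi> x = ereal a \<Longrightarrow> conjugate \<Psi> (D x) = ereal (D x x - a)"
  by (rule conjugate_subgradient[OF D_subgradient])

lemma conj_convex: "convex_fun (conjugate \<Psi>)"
  by (rule convex_fun_conjugate[OF \<Psi>_proper])

text \<open>At a boundary point the normal directions would be directions along which the conjugate is
  affine.\<close>

lemma dom_subdifferential_in_interior:
  assumes p: "p \<in> subdifferential \<Psi> x"
  shows "x \<in> U"
proof (rule ccontr)
  assume "x \<notin> U"
  obtain n :: "'a \<Rightarrow>\<^sub>L real" where n: "\<And>z. z \<in> U \<Longrightarrow> n z < n x"
    using separate_open_convex[OF open_interior convex_U U_nonempty \<open>x \<notin> U\<close>] by blast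
  obtain a where a: "\<Psi> x = ereal a" using subdifferential_finite[OF \<Psi>_proper p] .
  obtain u where u: "u \<in> U" using U_nonempty by blast
  have n_le: "n z \<le> n x" if z: "z \<in> edom \<Psi>" for z
  proof (rule ccontr)
    assume "\<not> n z \<le> n x"
    then have zx: "n x < n z" by simp
    have ux: "n u < n x" using n u by blast
    \<comment> \<open>The mixture of \<open>z\<close> with the interior point \<open>u\<close> is
      placed on the hyperplane \<open>n = n x\<close>, although it belongs to \<open>U\<close>,
      where \<open>n\<close> is strictly smaller.\<close>
    define t where "t = (n z - n x) / (n z - n u)"
    have t: "0 < t" "t \<le> 1" using zx ux by (auto simp: t_def)
    have "(1 - t) *\<^sub>R z + t *\<^sub>R u \<in> U"
      by (rule interior_convex_mix[OF convex_edom[OF \<Psi>_convex] u z t])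
    then have "n ((1 - t) *\<^sub>R z + t *\<^sub>R u) < n x" by (rule n)
    moreover have "n ((1 - t) *\<^sub>R z + t *\<^sub>R u) = n z - t * (n z - n u)"
      by (simp only: blinfun.add_right blinfun.scaleR_right) (simp add: algebra_simps)
    moreover have "t * (n z - n u) = n z - n x" using zx ux by (simp add: t_def)
    ultimately show False by simp
  qed
  have pn: "p + n \<in> subdifferential \<Psi> x"
  proof (rule subdifferentialI[where \<Phi>=\<Psi>])
    show "\<Psi> x = ereal a" by fact
    fix z b assume z: "\<Psi> z \<le> ereal b"
    then have "n z \<le> n x" by (intro n_le) (auto simp: mem_edom_iff)
    with subdifferentialD[OF p a z] show "a + (p + n) (z - x) \<le> b"
      by (simp add: blinfun.add_left blinfun.diff_right)
  qed
  \<comment> \<open>The convex set of subgradients at \<open>x\<close> falls under the strict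
    convexity hypothesis, while the conjugate is the affine function \<open>q x - a\<close> of
    \<open>q\<close> there. The distinct points \<open>p\<close> and \<open>p + n\<close> give the
    contradiction.\<close>
  have "subdifferential \<Psi> x \<subseteq> dom_subdifferential (conjugate \<Psi>)"
    using eval_in_subdifferential_conjugate[where \<Phi>=\<Psi> and x=x, OF _ a]
    by (auto simp: dom_subdifferential_def)
  then have strict: "strictly_convex_fun_on (subdifferential \<Psi> x) (conjugate \<Psi>)"
    by (intro conj_strictly_convex convex_subdifferential[where \<Phi>=\<Psi>, OF a])
  have conj: "conjugate \<Psi> q = ereal (q x - a)" if "q \<in> subdifferential \<Psi> x" for q
    using that a by (rule conjugate_subgradient)
  have mid: "(1 - 1 / 2) *\<^sub>R p + (1 / 2) *\<^sub>R (p + n) \<in> subdifferential \<Psi> x"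
    by (rule convexD_alt[OF convex_subdifferential[where \<Phi>=\<Psi>, OF a] p pn]) auto
  have "p \<noteq> p + n" using n[OF u] by auto
  moreover have "1 / 2 \<in> {0<..<1::real}" by simp
  ultimately have "conjugate \<Psi> ((1 - 1 / 2) *\<^sub>R p + (1 / 2) *\<^sub>R (p + n))
      < ereal (1 - 1 / 2) * conjugate \<Psi> p + ereal (1 / 2) * conjugate \<Psi> (p + n)"
    using strict[unfolded strictly_convex_fun_on_def] p pn by blast
  then have "((1 - 1 / 2) *\<^sub>R p + (1 / 2) *\<^sub>R (p + n)) x - a
      < (1 - 1 / 2) * (p x - a) + (1 / 2) * ((p + n) x - a)"
    unfolding conj[OF mid] conj[OF p] conj[OF pn] by simp
  then show False
    by (simp only: blinfun.add_left blinfun.scaleR_left) (simp add: field_simps)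
qed

text \<open>Evaluation at \<open>x\<close> is a subgradient of the conjugate at \<open>D x\<close>,
  and a Gateaux derivative is the only subgradient.\<close>

lemma conj_deriv:
  assumes "x \<in> U"
  shows "has_gateaux_deriv (conjugate \<Psi>) (eval_blinfun x) (D x)"
proof -
  obtain a where a: "\<Psi> x = ereal a" using \<Psi>_finite[OF assms] .
  obtain F where F: "has_gateaux_deriv (conjugate \<Psi>) F (D x)"
    using conj_gateaux assms by (auto simp: gateaux_differentiable_on_def)
  have "eval_blinfun x = F"
    by (rule subgradient_eq_gateaux_deriv[OF _ F conj_D[OF assms a]])
      (rule eval_in_subdifferential_conjugate[OF D_subgradient[OF assms] a])
  with F show ?thesis by simp
qed

text \<open>The point \<open>x\<close> is recovered from \<open>D x\<close> as the derivative of the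
  conjugate there.\<close>

lemma D_inj:
  assumes "x \<in> U" "y \<in> U" "D x = D y"
  shows "x = y"
proof (rule blinfun_separates_points)
  fix p :: "'a \<Rightarrow>\<^sub>L real"
  have "eval_blinfun x = eval_blinfun y"
    using conj_deriv assms gateaux_deriv_eq by metis
  then show "p x = p y" by (metis eval_blinfun_apply)
qed

text \<open>The conjugate is locally bounded at \<open>p\<close> and hence has a subgradient there,
  which by reflexivity is evaluation at some \<open>x\<close>. Then \<open>p\<close> is a
  subgradient of \<open>\<Psi>\<close> at \<open>x\<close>, and such points lie in
  \<open>U\<close>.\<close>

lemma interior_conj_dom:
  assumes p: "p \<in> interior (edom (conjugate \<Psi>))"
  obtains x where "x \<in> U" "p = D x"
proof -
  obtain r c where r: "r > 0" "\<And>q. dist q p < r \<Longrightarrow> conjugate \<Psi> q \<le> ereal c"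
    using convex_fun_bounded_near_interior[OF conj_convex closed_sublevel_conjugate p] by blast
  have "conjugate \<Psi> p \<noteq> \<infinity>" using p interior_subset by (auto simp: edom_def)
  then obtain b where b: "conjugate \<Psi> p = ereal b"
    using conjugate_not_minus_infinity[OF \<Psi>_proper, of p] by (cases "conjugate \<Psi> p") auto
  obtain F where F: "F \<in> subdifferential (conjugate \<Psi>) p"
    using subdifferential_nonempty[OF conj_convex b r] by blast
  obtain x where "F = eval_blinfun x" by (rule bidual_eval)
  with F have "p \<in> subdifferential \<Psi> x"
    by (intro subgradient_of_eval_in_subdifferential_conjugate[OF \<Psi>_Gamma _ b]) simp
  then show thesis
    using that dom_subdifferential_in_interior D_unique by metis
qed

section \<open>The Vainberg--Bregman functional and information properties\<close>

lemma \<Psi>_eq_real: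
  assumes "x \<in> U"
  shows "\<Psi> x = ereal (real_of_ereal (\<Psi> x))"
proof -
  obtain a where "\<Psi> x = ereal a" using \<Psi>_finite[OF assms] .
  then show ?thesis by simp
qed

text \<open>A real-valued version, meaningful when both arguments lie in \<open>U\<close>, that
  reduces the three point identity to linear arithmetic.\<close>

definition B :: "'a \<Rightarrow> 'a \<Rightarrow> real" where
  "B x y = real_of_ereal (\<Psi> x) - real_of_ereal (\<Psi> y) - D y (x - y)"

lemma vb_eq_B:
  assumes x: "x \<in> U" and y: "y \<in> U"
  shows "vb_functional \<Psi> x y = ereal (B x y)"
proof -
  obtain a b where "\<Psi> x = ereal a" "\<Psi> y = ereal b"
    using \<Psi>_finite[OF x] \<Psi>_finite[OF y] by metis
  with y show ?thesis by (simp add: vb_functional_def B_def)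
qed

lemma vb_nonneg: "0 \<le> vb_functional \<Psi> x y"
proof (cases "y \<in> U")
  case y: True
  obtain b where b: "\<Psi> y = ereal b" using \<Psi>_finite[OF y] .
  show ?thesis
  proof (cases "\<Psi> x")
    case (real a)
    have "b + D y (x - y) \<le> a"
      using subdifferentialD[OF D_subgradient[OF y] b, of x a] real by simp
    then show ?thesis using y b real by (simp add: vb_functional_def)
  qed (use \<Psi>_not_minus_infinity y b in \<open>auto simp: vb_functional_def\<close>)
qed (simp add: vb_functional_def)

lemma vb_zero_imp_subgradient:
  assumes y: "y \<in> U" and "vb_functional \<Psi> x y = 0"
  shows "D y \<in> subdifferential \<Psi> x"
proof -
  obtain b where b: "\<Psi> y = ereal b" using \<Psi>_finite[OF y] .
  obtain a where a: "\<Psi> x = ereal a"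
    using assms b \<Psi>_not_minus_infinity[of x] by (cases "\<Psi> x") (auto simp: vb_functional_def)
  have eq: "a = b + D y (x - y)" using assms a b by (simp add: vb_functional_def)
  show ?thesis
  proof (rule subdifferentialI[where \<Phi>=\<Psi>])
    show "\<Psi> x = ereal a" by fact
    fix z c assume "\<Psi> z \<le> ereal c"
    from subdifferentialD[OF D_subgradient[OF y] b this] show "a + D y (z - x) \<le> c"
      by (simp add: eq blinfun.diff_right)
  qed
qed

text \<open>A zero makes \<open>D y\<close> a subgradient at \<open>x\<close> too. This forces
  \<open>x\<close> into \<open>U\<close>, where \<open>D x = D y\<close>, and \<open>D\<close> is
  injective.\<close>

lemma vb_zero_imp_eq:
  assumes "y \<in> U" "vb_functional \<Psi> x y = 0"
  shows "x = y"
  using vb_zero_imp_subgradient[OF assms] assms(1)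
  by (metis D_inj D_unique dom_subdifferential_in_interior)

lemma vb_refl: "x \<in> U \<Longrightarrow> vb_functional \<Psi> x x = 0"
  by (simp add: vb_eq_B B_def zero_ereal_def)

lemma B_nonneg: "x \<in> U \<Longrightarrow> y \<in> U \<Longrightarrow> 0 \<le> B x y"
  using vb_nonneg[of x y] by (simp add: vb_eq_B)

lemma B_three_point: "B x y = B x z + B z y + (D z - D y) (x - z)"
  by (simp add: B_def blinfun.diff_left blinfun.diff_right)

text \<open>Writing \<open>q = D y\<close> turns the functional into the gap in Young's inequality
  for \<open>p\<close> and \<open>y\<close>. The gap vanishes exactly when \<open>p\<close> is a
  subgradient at \<open>y\<close>, and \<open>D y\<close> is the only one.\<close>

lemma vb_conj_cases:
  fixes p q :: "'a \<Rightarrow>\<^sub>L real"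
  assumes q: "q \<in> interior (edom (conjugate \<Psi>))"
  shows "0 \<le> vb_functional (conjugate \<Psi>) p q"
    and "vb_functional (conjugate \<Psi>) p q = 0 \<longleftrightarrow> p = q"
proof -
  obtain y where y: "y \<in> U" "q = D y" using interior_conj_dom[OF q] .
  obtain a where a: "\<Psi> y = ereal a" using \<Psi>_finite[OF y(1)] .
  have cq: "conjugate \<Psi> q = ereal (q y - a)" using conj_D[OF y(1) a] y(2) by simp
  have dq: "gateaux_deriv (conjugate \<Psi>) q = eval_blinfun y"
    using gateaux_deriv_eq[OF conj_deriv[OF y(1)]] y(2) by simp
  have ge: "ereal (p y - a) \<le> conjugate \<Psi> p"
    using a by (intro conjugate_ge) simp
  have vb: "vb_functional (conjugate \<Psi>) p q = conjugate \<Psi> p - ereal (p y - a)"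
    using q by (cases "conjugate \<Psi> p") (auto simp: vb_functional_def dq cq blinfun.diff_left)
  show "0 \<le> vb_functional (conjugate \<Psi>) p q"
    unfolding vb using ge by (cases "conjugate \<Psi> p") auto
  show "vb_functional (conjugate \<Psi>) p q = 0 \<longleftrightarrow> p = q"
  proof
    assume "vb_functional (conjugate \<Psi>) p q = 0"
    then have cp: "conjugate \<Psi> p = ereal (p y - a)"
      unfolding vb by (cases "conjugate \<Psi> p") auto
    have "p \<in> subdifferential \<Psi> y"
    proof (rule subdifferentialI[where \<Phi>=\<Psi>])
      show "\<Psi> y = ereal a" by fact
      fix z b assume "\<Psi> z \<le> ereal b"
      with conjugate_leD[of \<Psi> p "p y - a" z b] show "a + p (z - y) \<le> b"
        by (simp add: cp blinfun.diff_right)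
    qed
    then show "p = q" using D_unique y by blast
  next
    assume "p = q"
    then show "vb_functional (conjugate \<Psi>) p q = 0"
      unfolding vb using cq by simp
  qed
qed

text \<open>Nonnegativity and definiteness extend to the whole dual because the value is
  \<open>\<infinity>\<close> when \<open>q\<close> is off the interior; the zero on the diagonal is
  available on the interior only.\<close>

lemma vb_conj_information:
  "0 \<le> vb_functional (conjugate \<Psi>) p q"
  "vb_functional (conjugate \<Psi>) p q = 0 \<Longrightarrow> p = q"
  "information_on (interior (edom (conjugate \<Psi>))) (vb_functional (conjugate \<Psi>))"
  using vb_conj_cases unfolding information_on_def
  by (auto simp: vb_functional_def split: if_splits)

lemma vb_information:
  assumes "U = UNIV"
  shows "information_on UNIV (vb_functional \<Psi>)"
  unfolding information_on_def
proof (intro ballI conjI iffI)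
  fix x y
  have U: "z \<in> U" for z using assms by simp
  show "0 \<le> vb_functional \<Psi> x y" by (rule vb_nonneg)
  show "vb_functional \<Psi> x y = 0 \<Longrightarrow> x = y" by (rule vb_zero_imp_eq[OF U])
  show "x = y \<Longrightarrow> vb_functional \<Psi> x y = 0" using vb_refl[OF U] by simp
qed

text \<open>Along a sequence in \<open>U\<close> converging to a boundary point the derivatives would be bounded,
  because \<open>\<epsilon>\<close> is uniform, and a weak cluster point of them would be a subgradient there.\<close>

lemma interior_UNIV:
  assumes \<epsilon>: "\<epsilon> > 0" and bound: "\<And>F. F \<in> dom_inv_subdifferential (conjugate \<Psi>) \<Longrightarrow>
    (SUP p\<in>(\<Union>G\<in>cball 0 1. inv_subdifferential (conjugate \<Psi>) (F + \<epsilon> *\<^sub>R G)). ereal (norm p)) < \<infinity>"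
  shows "U = UNIV"
proof -
  have eval_D: "D x \<in> inv_subdifferential (conjugate \<Psi>) (eval_blinfun x)" if x: "x \<in> U" for x
    unfolding inv_subdifferential_def
    by (metis (mono_tags) \<Psi>_finite[OF x] eval_in_subdifferential_conjugate D_subgradient[OF x]
        mem_Collect_eq)
  have bounded_D: "\<exists>M. \<forall>y\<in>U. dist y x \<le> \<epsilon> \<longrightarrow> norm (D y) \<le> M" if x: "x \<in> U" for x
  proof -
    define A where
      "A = (\<Union>G\<in>cball 0 1. inv_subdifferential (conjugate \<Psi>) (eval_blinfun x + \<epsilon> *\<^sub>R G))"
    have mem: "D y \<in> A" if y: "y \<in> U" "dist y x \<le> \<epsilon>" for y
    proof -
      \<comment> \<open>The canonical embedding does not increase norms, so
        \<open>dist y x \<le> \<epsilon>\<close> makes \<open>G\<close> an element of the unit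
        ball.\<close>
      define G where "G = (1 / \<epsilon>) *\<^sub>R (eval_blinfun y - eval_blinfun x)"
      have "norm (eval_blinfun y - eval_blinfun x) \<le> norm (y - x)"
      proof (rule norm_blinfun_bound)
        fix p :: "'a \<Rightarrow>\<^sub>L real"
        show "norm ((eval_blinfun y - eval_blinfun x) p) \<le> norm (y - x) * norm p"
          using norm_blinfun[of p "y - x"]
          by (simp add: blinfun.diff_left blinfun.diff_right mult.commute)
      qed simp
      then have "norm G \<le> 1" using y(2) \<epsilon> by (simp add: G_def dist_norm divide_simps)
      moreover have "eval_blinfun x + \<epsilon> *\<^sub>R G = eval_blinfun y" using \<epsilon> by (simp add: G_def)
      ultimately show ?thesis
        unfolding A_def using eval_D[OF y(1)] by (intro UN_I[of G]) auto
    qed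
    have "(SUP p\<in>A. ereal (norm p)) < \<infinity>"
      unfolding A_def using eval_D[OF x] by (intro bound) (auto simp: dom_inv_subdifferential_def)
    then obtain M where "(SUP p\<in>A. ereal (norm p)) \<le> ereal M"
      by (metis ereal_dense2 less_imp_le)
    then have "norm p \<le> M" if "p \<in> A" for p
      using SUP_upper2[OF that, of _ "\<lambda>p. ereal (norm p)"] that
      by (metis SUP_upper ereal_less_eq(3) order_trans)
    then show ?thesis using mem by blast
  qed
  have closed: "a \<in> U"
    if x: "x \<in> U" and s: "s \<longlonglongrightarrow> a" "\<And>n. s n \<in> U" "\<And>n. dist (s n) x \<le> \<epsilon>" for x a s
  proof -
    obtain M where M: "\<And>y. y \<in> U \<Longrightarrow> dist y x \<le> \<epsilon> \<Longrightarrow> norm (D y) \<le> M"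
      using bounded_D[OF x] by blast
    then have Ms: "norm (D (s n)) \<le> M" for n using s by blast
    obtain p :: "'a \<Rightarrow>\<^sub>L real"
      where p: "\<And>u c. eventually (\<lambda>n. D (s n) u \<le> c) sequentially \<Longrightarrow> p u \<le> c"
      by (rule bounded_blinfun_seq_cluster[of "\<lambda>n. D (s n)" M, OF Ms]) blast
    have lim: "L + p (z - a) \<le> b" if L: "ereal L < \<Psi> a" and z: "\<Psi> z \<le> ereal b" for L z b
    proof -
      have "p (z - a) \<le> b - L + e" if e: "e > 0" for e
      proof (rule p)
        obtain r where r: "r > 0" "\<And>z. dist z a < r \<Longrightarrow> ereal L < \<Psi> z"
          using lower_semicontinuousD[OF \<Psi>_lsc L] by blast
        \<comment> \<open>The first bound keeps \<open>\<Psi> (s n)\<close> above \<open>L\<close>;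
          the second makes the error \<open>D (s n) (s n - a)\<close> at most \<open>e\<close>, with
          \<open>\<bar>M\<bar> + 1\<close> as a positive bound on the derivatives.\<close>
        define \<delta> where "\<delta> = min r (e / (\<bar>M\<bar> + 1))"
        have "\<delta> > 0" using r e by (simp add: \<delta>_def)
        with s(1) have "\<forall>\<^sub>F n in sequentially. dist (s n) a < \<delta>" by (rule tendstoD)
        then show "\<forall>\<^sub>F n in sequentially. D (s n) (z - a) \<le> b - L + e"
        proof eventually_elim
          case (elim n)
          obtain c where c: "\<Psi> (s n) = ereal c" using \<Psi>_finite[OF s(2)] .
          have "L < c" using r(2)[of "s n"] elim c by (simp add: \<delta>_def)
          have "D (s n) (s n - a) \<le> norm (D (s n)) * norm (s n - a)"
            using norm_blinfun[of "D (s n)" "s n - a"] by simp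
          also have "\<dots> \<le> (\<bar>M\<bar> + 1) * (e / (\<bar>M\<bar> + 1))"
            using Ms[of n] elim by (intro mult_mono) (auto simp: \<delta>_def dist_norm)
          also have "\<dots> = e"
            by (simp add: add_nonneg_eq_0_iff)
          finally have "D (s n) (s n - a) \<le> e" .
          with subdifferentialD[OF D_subgradient[OF s(2)] c z] \<open>L < c\<close> show ?case
            by (simp add: blinfun.diff_right)
        qed
      qed
      then have "p (z - a) \<le> b - L" by (rule field_le_epsilon)
      then show ?thesis by simp
    qed
    obtain w where w: "\<Psi> x = ereal w" using \<Psi>_finite[OF x] .
    have "\<Psi> a \<noteq> \<infinity>"
      using lim[of "w - p (x - a) + 1" x w] w by auto
    then obtain \<alpha> where \<alpha>: "\<Psi> a = ereal \<alpha>"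
      using \<Psi>_not_minus_infinity[of a] by (cases "\<Psi> a") auto
    have "p \<in> subdifferential \<Psi> a"
    proof (rule subdifferentialI[where \<Phi>=\<Psi>])
      show "\<Psi> a = ereal \<alpha>" by fact
      fix z b assume z: "\<Psi> z \<le> ereal b"
      have "L \<le> b - p (z - a)" if "L < \<alpha>" for L
        using lim[of L z b] that \<alpha> z by simp
      then have "\<alpha> \<le> b - p (z - a)" by (rule dense_le)
      then show "\<alpha> + p (z - a) \<le> b" by simp
    qed
    then show "a \<in> U" by (rule dom_subdifferential_in_interior)
  qed
  have "closed U"
    unfolding closed_sequential_limits
  proof (intro allI impI)
    fix s a assume *: "(\<forall>n. s n \<in> U) \<and> s \<longlonglongrightarrow> a"
    then have "\<forall>\<^sub>F n in sequentially. dist (s n) a < \<epsilon> / 2" using \<epsilon> by (intro tendstoD) auto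
    then obtain N where N: "\<And>n. n \<ge> N \<Longrightarrow> dist (s n) a < \<epsilon> / 2"
      by (auto simp: eventually_sequentially)
    \<comment> \<open>A late term \<open>s N\<close> serves as the centre: by the uniform choice of
      \<open>\<epsilon>\<close>, the whole tail lies within \<open>\<epsilon>\<close> of it.\<close>
    show "a \<in> U"
    proof (rule closed[of "s N" "\<lambda>n. s (n + N)"])
      show "(\<lambda>n. s (n + N)) \<longlonglongrightarrow> a" using * by (intro LIMSEQ_ignore_initial_segment) simp
      show "dist (s (n + N)) (s N) \<le> \<epsilon>" for n
        using N[of "n + N"] N[of N] dist_triangle2[of "s (n + N)" "s N" a] by simp
    qed (use * in auto)
  qed
  then show "U = UNIV"
    using clopen[of U] U_nonempty by auto
qed

section \<open>Characterisation, uniqueness and existence of right projections\<close>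

text \<open>Sufficiency is the three point identity with \<open>B w z\<close> nonnegative. For
  necessity, minimality along the segment from \<open>D w\<close> to \<open>D z\<close> bounds the
  derivative of the conjugate at \<open>D w\<close> from below, and that derivative is evaluation at
  \<open>w\<close>.\<close>

lemma minimiser_iff_variational:
  assumes K: "K \<subseteq> U" "convex (D ` K)" and x: "x \<in> U" and w: "w \<in> K"
  shows "w \<in> right_minimisers \<Psi> K x \<longleftrightarrow> (\<forall>z\<in>K. 0 \<le> (D w - D z) (x - w))"
proof -
  have min_iff: "w \<in> right_minimisers \<Psi> K x \<longleftrightarrow> (\<forall>z\<in>K. B x w \<le> B x z)"
    using K x w by (auto simp: right_minimisers_def vb_eq_B subset_iff)
  have wU: "w \<in> U" using K w by blast
  show ?thesis
    unfolding min_iff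
  proof (intro iffI ballI)
    fix z assume "\<forall>z\<in>K. 0 \<le> (D w - D z) (x - w)" and z: "z \<in> K"
    then show "B x w \<le> B x z"
      using B_three_point[of x z w] B_nonneg[of w z] wU K by fastforce
  next
    fix z assume min: "\<forall>z\<in>K. B x w \<le> B x z" and z: "z \<in> K"
    have c: "conjugate \<Psi> (D y) = ereal (D y y - real_of_ereal (\<Psi> y))" if "y \<in> U" for y
      by (rule conj_D[OF that \<Psi>_eq_real[OF that]])
    have "(D z - D w) x \<le> eval_blinfun w (D z - D w)"
    proof (rule gateaux_deriv_ge[OF conj_deriv[OF wU] c[OF wU]])
      fix t :: real assume t: "0 < t" "t < 1"
      have "(1 - t) *\<^sub>R D w + t *\<^sub>R D z \<in> D ` K"
        using K(2) w z t by (intro convexD_alt) auto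
      then obtain y where y: "y \<in> K" "D y = D w + t *\<^sub>R (D z - D w)"
        by (auto simp: algebra_simps)
      have "B x w \<le> B x y" using min y by blast
      then have "D w w - real_of_ereal (\<Psi> w) + (D y - D w) x \<le> D y y - real_of_ereal (\<Psi> y)"
        by (simp add: B_def blinfun.diff_left blinfun.diff_right)
      moreover have "(D y - D w) x = t * (D z - D w) x"
        by (simp add: y(2) blinfun.scaleR_left)
      ultimately show "ereal (D w w - real_of_ereal (\<Psi> w) + t * (D z - D w) x)
          \<le> conjugate \<Psi> (D w + t *\<^sub>R (D z - D w))"
        using c[of y] y K by (auto simp: subset_iff)
    qed
    then show "0 \<le> (D w - D z) (x - w)"
      by (simp add: blinfun.diff_left blinfun.diff_right)
  qed
qed

text \<open>Adding the two variational inequalities gives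
  \<open>(D w - D v) (w - v) \<le> 0\<close>, while the left side equals
  \<open>B w v + B v w\<close>, a sum of nonnegative terms.\<close>

lemma minimiser_unique:
  assumes K: "K \<subseteq> U" "convex (D ` K)" and x: "x \<in> U"
    and w: "w \<in> right_minimisers \<Psi> K x" "v \<in> right_minimisers \<Psi> K x"
  shows "w = v"
proof -
  have wv: "w \<in> K" "v \<in> K" using w by (auto simp: right_minimisers_def)
  then have U: "w \<in> U" "v \<in> U" using K by auto
  have "0 \<le> (D w - D v) (x - w)" "0 \<le> (D v - D w) (x - v)"
    using minimiser_iff_variational[OF K x] w wv by blast+
  moreover have "B w v + B v w = (D w - D v) (w - v)"
    by (simp add: B_def blinfun.diff_left blinfun.diff_right)
  ultimately have "B w v + B v w \<le> 0"
    by (simp add: blinfun.diff_left blinfun.diff_right)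
  then have "B w v = 0"
    using B_nonneg[of w v] B_nonneg[of v w] U by simp
  then have "vb_functional \<Psi> w v = 0" by (simp add: vb_eq_B[OF U] zero_ereal_def)
  with U show ?thesis by (intro vb_zero_imp_eq)
qed

text \<open>This is the direct method on the dual side: the derivatives along a minimising sequence
  are bounded, a cluster functional of them stays in the closed convex set, and it attains the
  infimum.\<close>

lemma minimiser_exists:
  assumes K: "K \<subseteq> U" "convex (D ` K)" "closed (D ` K)" "K \<noteq> {}" and x: "x \<in> U"
  shows "right_minimisers \<Psi> K x \<noteq> {}"
proof -
  define m where "m = Inf (B x ` K)"
  have bdd: "bdd_below (B x ` K)"
    using B_nonneg x K by (intro bdd_belowI2[of _ 0]) auto
  have "\<exists>z\<in>K. B x z < m + 1 / (real n + 1)" for n :: nat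
  proof -
    have "Inf (B x ` K) < m + 1 / (real n + 1)" unfolding m_def by simp
    then show ?thesis using cInf_less_iff[of "B x ` K"] bdd K by auto
  qed
  then obtain s where s: "\<And>n. s n \<in> K" "\<And>n. B x (s n) < m + 1 / (real n + 1)"
    by metis
  have sU: "s n \<in> U" for n using s K by blast
  define \<psi> where "\<psi> y = real_of_ereal (\<Psi> y)" for y
  \<comment> \<open>Young's inequality in a form linear in \<open>D (s n)\<close>: it supplies the
    norm bound here and passes to the cluster functional below.\<close>
  have young: "D (s n) (z - x) \<le> B x (s n) + b - \<psi> x" if "\<Psi> z \<le> ereal b" for n z b
    using subdifferentialD[OF D_subgradient[OF sU[of n]] \<Psi>_eq_real[OF sU[of n]] that]
    by (simp add: B_def \<psi>_def blinfun.diff_right)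
  obtain r c where r: "r > 0" "\<And>z. dist z x < r \<Longrightarrow> \<Psi> z \<le> ereal c"
    using convex_fun_bounded_near_interior[OF \<Psi>_convex closed_sublevel[OF \<Psi>_lsc] x] by blast
  \<comment> \<open>The summand \<open>1\<close> covers the excess \<open>1 / (real n + 1)\<close>
    of the minimising sequence over \<open>m\<close>.\<close>
  define Q where "Q = m + 1 + c - \<psi> x"
  have near: "D (s n) u \<le> Q" if "norm u < r" for n u
  proof -
    have "\<Psi> (x + u) \<le> ereal c" by (rule r(2)) (simp add: that dist_norm)
    from young[OF this] have "D (s n) u \<le> B x (s n) + c - \<psi> x" by simp
    moreover have "1 / (real n + 1) \<le> 1" by simp
    ultimately show ?thesis using s(2)[of n] unfolding Q_def by linarith
  qed
  have bound: "norm (D (s n)) \<le> 2 * Q / r" for n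
  proof (rule norm_blinfun_bound)
    have "0 \<le> Q" using near[of 0 n] r by simp
    then show "0 \<le> 2 * Q / r" using r by simp
    fix u
    show "norm (D (s n) u) \<le> 2 * Q / r * norm u"
    proof (cases "u = 0")
      case False
      define k where "k = r / (2 * norm u)"
      have k: "k > 0" "norm (k *\<^sub>R u) < r" using False r by (auto simp: k_def)
      have "k * D (s n) u \<le> Q" "k * - D (s n) u \<le> Q"
        using near[of "k *\<^sub>R u" n] near[of "- (k *\<^sub>R u)" n] k
        by (auto simp: blinfun.scaleR_right blinfun.minus_right)
      then have "k * \<bar>D (s n) u\<bar> \<le> Q" by (auto simp: abs_if)
      then have "\<bar>D (s n) u\<bar> \<le> Q / k" using k by (simp add: pos_le_divide_eq mult.commute)
      then show ?thesis by (simp add: k_def field_simps)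
    qed simp
  qed
  obtain p :: "'a \<Rightarrow>\<^sub>L real"
    where p: "\<And>u c. eventually (\<lambda>n. D (s n) u \<le> c) sequentially \<Longrightarrow> p u \<le> c"
    by (rule bounded_blinfun_seq_cluster[of "\<lambda>n. D (s n)", OF bound]) blast
  \<comment> \<open>A separating functional on the dual is, by reflexivity, evaluation at a point
    \<open>u\<close>, where the cluster property of \<open>p\<close> can be tested.\<close>
  have "p \<in> D ` K"
  proof (rule ccontr)
    assume "p \<notin> D ` K"
    then obtain F :: "('a \<Rightarrow>\<^sub>L real) \<Rightarrow>\<^sub>L real" and d
      where d: "d > 0" and F: "\<And>q. q \<in> D ` K \<Longrightarrow> F q \<le> F p - d"
      using separate_closed_convex[OF K(3,2), of p] K(4) by blast
    obtain u where u: "F = eval_blinfun u" by (rule bidual_eval)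
    have "D (s n) u \<le> p u - d" for n using F[of "D (s n)"] s(1) by (simp add: u)
    then have "p u \<le> p u - d" by (intro p) simp
    with d show False by simp
  qed
  then obtain w where w: "w \<in> K" "p = D w" by blast
  \<comment> \<open>Lower semicontinuity at the limit: \<open>young\<close> is applied with
    \<open>z = w\<close>, and the left side becomes \<open>D w (w - x)\<close> for the cluster
    functional.\<close>
  have "B x w \<le> m + e" if e: "e > 0" for e
  proof -
    have "p (w - x) \<le> m + e + \<psi> w - \<psi> x"
    proof (rule p)
      obtain N where N: "1 / (real N + 1) < e"
        using reals_Archimedean[OF e] by (auto simp: inverse_eq_divide add.commute)
      show "\<forall>\<^sub>F n in sequentially. D (s n) (w - x) \<le> m + e + \<psi> w - \<psi> x"
        using eventually_ge_at_top[of N]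
      proof eventually_elim
        case (elim n)
        then have "1 / (real n + 1) \<le> 1 / (real N + 1)" by (simp add: field_simps)
        moreover have "\<Psi> w \<le> ereal (\<psi> w)" unfolding \<psi>_def using \<Psi>_eq_real w K by fastforce
        ultimately show ?case using young[of w "\<psi> w" n] s(2)[of n] N by simp
      qed
    qed
    then show ?thesis by (simp add: B_def w(2) \<psi>_def blinfun.diff_right)
  qed
  then have "B x w \<le> m" by (rule field_le_epsilon)
  then have "B x w \<le> B x z" if "z \<in> K" for z
    using cINF_lower[OF bdd that] unfolding m_def by simp
  then have "w \<in> right_minimisers \<Psi> K x"
    using w K x by (auto simp: right_minimisers_def vb_eq_B subset_iff)
  then show ?thesis by blast
qed

lemma right_minimisers_eq:
  assumes K: "K \<subseteq> U" "convex (D ` K)" "closed (D ` K)" "K \<noteq> {}" and x: "x \<in> U"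
  shows "right_minimisers \<Psi> K x = {right_projection \<Psi> K x}"
proof -
  obtain w where "w \<in> right_minimisers \<Psi> K x" using minimiser_exists[OF K x] by blast
  then have "right_minimisers \<Psi> K x = {w}"
    using minimiser_unique[OF K(1,2) x] by blast
  then show ?thesis by (simp add: right_projection_def)
qed

theorem right_chebyshev:
  assumes K: "K \<subseteq> U" "convex (D ` K)" "closed (D ` K)" "K \<noteq> {}"
  shows "right_chebyshev \<Psi> K"
  unfolding right_chebyshev_def is_singleton_def using K(1) right_minimisers_eq[OF K] by blast

lemma three_point_iff:
  assumes "x \<in> U" "z \<in> U" "y \<in> U"
  shows "vb_functional \<Psi> x z + vb_functional \<Psi> z y \<le> vb_functional \<Psi> x y
    \<longleftrightarrow> 0 \<le> (D z - D y) (x - z)"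
  using assms B_three_point[of x y z] by (simp add: vb_eq_B)

text \<open>Both solution sets coincide with the singleton of minimisers, the second one through the
  three point identity, so uniqueness of solutions comes for free.\<close>

theorem right_pythagorean:
  assumes K: "K \<subseteq> U" "convex (D ` K)" "closed (D ` K)" "K \<noteq> {}"
  shows "right_pythagorean \<Psi> K"
proof -
  have 1: "{z\<in>K. \<forall>y\<in>K. 0 \<le> (D z - D y) (x - z)} = {right_projection \<Psi> K x}" if x: "x \<in> U" for x
  proof -
    have "{z\<in>K. \<forall>y\<in>K. 0 \<le> (D z - D y) (x - z)} = right_minimisers \<Psi> K x"
      using minimiser_iff_variational[OF K(1,2) x] by (auto simp: right_minimisers_def)
    then show ?thesis using right_minimisers_eq[OF K x] by simp
  qed
  have 2: "{z\<in>K. \<forall>y\<in>K. vb_functional \<Psi> x z + vb_functional \<Psi> z y \<le> vb_functional \<Psi> x y}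
      = {right_projection \<Psi> K x}" if x: "x \<in> U" for x
    unfolding 1[OF x, symmetric]
  proof (intro Collect_cong conj_cong ball_cong refl)
    fix z y assume "z \<in> K" "y \<in> K"
    then have "z \<in> U" "y \<in> U" using K(1) by auto
    then show "(vb_functional \<Psi> x z + vb_functional \<Psi> z y \<le> vb_functional \<Psi> x y)
        = (0 \<le> (D z - D y) (x - z))"
      by (rule three_point_iff[OF x])
  qed
  show ?thesis
    unfolding right_pythagorean_def using right_chebyshev[OF K] by (auto simp: 1 2)
qed

theorem right_projection_in:
  assumes K: "K \<subseteq> U" "convex (D ` K)" "closed (D ` K)" "K \<noteq> {}" and x: "x \<in> U"
  shows "right_projection \<Psi> K x \<in> K"
  using right_minimisers_eq[OF K x] by (auto simp: right_minimisers_def)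

text \<open>An affine set contains the reflection \<open>2 *\<^sub>R D w - D y\<close> of
  \<open>D y\<close> in \<open>D w\<close>. The variational inequality at both points gives opposite
  signs, so the remainder in the three point identity vanishes.\<close>

theorem right_pythagorean_equality:
  assumes K: "K \<subseteq> U" "convex (D ` K)" "closed (D ` K)" "K \<noteq> {}" and x: "x \<in> U"
    and affine: "affine (D ` K)" and y: "y \<in> K"
  shows "vb_functional \<Psi> x y =
    vb_functional \<Psi> x (right_projection \<Psi> K x) + vb_functional \<Psi> (right_projection \<Psi> K x) y"
proof -
  define w where "w = right_projection \<Psi> K x"
  have w: "w \<in> K" unfolding w_def by (rule right_projection_in[OF K x])
  have vi: "0 \<le> (D w - D z) (x - w)" if "z \<in> K" for z
    using minimiser_iff_variational[OF K(1,2) x w] right_minimisers_eq[OF K x] that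
    by (auto simp: w_def)
  have "2 *\<^sub>R D w + (- 1) *\<^sub>R D y \<in> D ` K"
    by (rule affine[unfolded affine_def, rule_format]) (use w y in auto)
  then obtain z where z: "z \<in> K" "D z = 2 *\<^sub>R D w - D y" by auto
  have "(D w - D y) (x - w) = 0"
    using vi[OF y] vi[OF z(1)] by (simp add: z(2) scaleR_2 blinfun.diff_left blinfun.add_left)
  then have "B x y = B x w + B w y" using B_three_point[of x y w] by simp
  moreover have "w \<in> U" "y \<in> U" using w y K by auto
  ultimately show ?thesis using x by (simp add: vb_eq_B w_def[symmetric])
qed

end

section \<open>Reduction of the three cases to strict convexity of the conjugate\<close>

theorem proposition3p1:
  fixes \<Psi> :: "'a::banach \<Rightarrow> ereal" and K :: "'a set"
  assumes "reflexive_space TYPE('a)"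
    and "\<Psi> \<in> Gamma_G"
    and "gateaux_differentiable_on (conjugate \<Psi>) (gateaux_deriv \<Psi> ` interior (edom \<Psi>))"
    and "gateaux_deriv \<Psi> ` interior (edom \<Psi>) \<noteq> {}"
    and "gateaux_deriv \<Psi> ` interior (edom \<Psi>) \<subseteq> interior (edom (conjugate \<Psi>))"
    and "K \<noteq> {}" and "K \<subseteq> interior (edom \<Psi>)"
    and "closed (gateaux_deriv \<Psi> ` K)" and "convex (gateaux_deriv \<Psi> ` K)"
    and "totally_convex_on (edom (conjugate \<Psi>)) (conjugate \<Psi>)
       \<or> (strictly_convex_fun_on (edom (conjugate \<Psi>)) (conjugate \<Psi>) \<and> supercoercive (conjugate \<Psi>))
       \<or> euler_legendre (conjugate \<Psi>)"
  shows "(right_chebyshev \<Psi> K \<and> right_pythagorean \<Psi> K)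
    \<and> right_projection \<Psi> K ` interior (edom \<Psi>) \<subseteq> interior (edom \<Psi>)
    \<and> ((\<forall>x. \<forall>y. 0 \<le> vb_functional (conjugate \<Psi>) x y \<and>
                 (vb_functional (conjugate \<Psi>) x y = 0 \<longrightarrow> x = y))
       \<and> information_on (interior (edom (conjugate \<Psi>))) (vb_functional (conjugate \<Psi>))
       \<and> (euler_legendre (conjugate \<Psi>) \<longrightarrow> information_on UNIV (vb_functional \<Psi>)))
    \<and> (affine (gateaux_deriv \<Psi> ` K) \<longrightarrow>
        (\<forall>x\<in>interior (edom \<Psi>). \<forall>y\<in>K.
           vb_functional \<Psi> x y =
             vb_functional \<Psi> x (right_projection \<Psi> K x) +
             vb_functional \<Psi> (right_projection \<Psi> K x) y))"
proof -
  have proper: "proper \<Psi>" using assms(2) by (auto simp: Gamma_G_def Gamma_def)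
  have fin: "conjugate \<Psi> p \<noteq> - \<infinity>" for p
    by (rule conjugate_not_minus_infinity[OF proper])
  have conj_proper: "proper (conjugate \<Psi>)"
    using assms(4,5) fin interior_subset[of "edom (conjugate \<Psi>)"] unfolding proper_def by blast
  \<comment> \<open>Case (c) contains this by definition of essential strict convexity; in the other
    cases strict convexity on the whole effective domain is inherited by subsets of the
    subdifferential domain.\<close>
  have strict: "strictly_convex_fun_on S (conjugate \<Psi>)"
    if S: "convex S" "S \<subseteq> dom_subdifferential (conjugate \<Psi>)" for S
  proof (cases "euler_legendre (conjugate \<Psi>)")
    case True
    then show ?thesis using S by (auto simp: euler_legendre_def ess_strictly_convex_def)
  next
    case False
    then have "strictly_convex_fun_on (edom (conjugate \<Psi>)) (conjugate \<Psi>)"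
      using assms(10) totally_convex_imp_strictly_convex[OF convex_fun_conjugate[OF proper] fin]
      by blast
    then show ?thesis
      by (rule strictly_convex_fun_on_subset)
        (use S dom_subdifferential_subset_edom[OF conj_proper] in blast)
  qed
  interpret dually_strictly_convex \<Psi>
    by unfold_locales (use assms strict in auto)
  note K = assms(7,9,8,6)
  \<comment> \<open>The uniform radius in essential strict convexity forces \<open>U = UNIV\<close>,
    so the functional vanishes on the whole diagonal.\<close>
  have "information_on UNIV (vb_functional \<Psi>)" if legendre: "euler_legendre (conjugate \<Psi>)"
  proof -
    from legendre obtain \<epsilon> where "\<epsilon> > 0"
      "\<And>F. F \<in> dom_inv_subdifferential (conjugate \<Psi>) \<Longrightarrow>
        (SUP p\<in>(\<Union>G\<in>cball 0 1. inv_subdifferential (conjugate \<Psi>) (F + \<epsilon> *\<^sub>R G)). ereal (norm p)) < \<infinity>"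
      unfolding euler_legendre_def ess_strictly_convex_def by blast
    then show ?thesis by (intro vb_information interior_UNIV)
  qed
  moreover have "right_projection \<Psi> K ` interior (edom \<Psi>) \<subseteq> interior (edom \<Psi>)"
    using right_projection_in[OF K] K(1) by blast
  ultimately show ?thesis
    using right_chebyshev[OF K] right_pythagorean[OF K] vb_conj_information
      right_pythagorean_equality[OF K]
    by (intro conjI allI impI ballI) simp_all
qed

end
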